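(* Let $\mathcal{C}$ be the set of all $(\rho,\theta)$ (with $\rho$ indexed by $\mathrm{pq}$, $\theta$ indexed by $\mathcal{V}\setminus\{s\}$, and $\rho_i=0$ for $i\in\mathrm{pv}$, $\rho_s=\theta_s=0$) such that $$|\theta_i-\theta_j|\le \frac{\pi}{2}\qquad\forall (i,j)\in\mathcal{E}$$ and $$\sum_{i\in\mathrm{pq}}\Big[\,2B_i-\sum_{j\in\mathrm{pv}\cup\{s\}}B_{ij}\frac{\exp(\rho_{ji})}{\cos(\theta_{ji})}\Big]_{ii}^{\mathrm{pq}}\;-\sum_{(i,j)\in\mathcal{E},\; i,j\in\mathrm{pq}}\frac{B_{ij}}{\cos(\theta_{ij})}\left[\begin{pmatrix}\exp(\rho_{ji}) & 1\\ 1& \exp(\rho_{ij})\end{pmatrix}\right]_{ij}^{\mathrm{pq}}\succeq 0 .$$ Then: (a) $\mathcal{C}$ is convex, $\mathcal{C}\subseteq\mathcal{D}$, and the energy function $E(\rho,\theta)$ is jointly convex in $(\rho,\theta)$ over $\mathcal{C}$. (b) If the network $(\mathcal{V},\mathcal{E})$ has a tree topology, then $\mathcal{D}=\mathcal{C}$. (c) $E$ is strictly convex on the interior $\mathrm{Int}(\mathcal{C})$.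
   Context: Network: $(\mathcal{V},\mathcal{E})$ is a finite simple graph; each edge is given one arbitrary orientation, so that for an edge between $i$ and $j$ exactly one of $(i,j),(j,i)$ is in $\mathcal{E}$; write $i\sim j$ if there is an edge between $i$ and $j$. Each edge carries a real parameter $B_{ij}=B_{ji}>0$; set $B_{ij}=0$ if $i\not\sim j$. The node set is a disjoint union $\mathcal{V}=\mathrm{pv}\cup\mathrm{pq}\cup\{s\}$, where $s$ is the slack bus. $B_i=\sum_{j\sim i}B_{ij}$. Variables: real numbers $\rho_i$ (log voltage magnitudes) and $\theta_i$ (phases), with the values $\rho_i=0$ for $i\in\mathrm{pv}$ and $\rho_s=\theta_s=0$ fixed. Thus the free variables are $\rho=(\rho_i)_{i\in\mathrm{pq}}$ and $\theta=(\theta_i)_{i\in\mathrm{pv}\cup\mathrm{pq}}$, and Hessians, convexity and interiors are with respect to these. Write $\rho_{ij}=\rho_i-\rho_j$, $\theta_{ij}=\theta_i-\theta_j$. Energy function: for fixed real constants $P_i$ ($i\in\mathrm{pv}\cup\mathrm{pq}$) and $Q_i$ ($i\in\mathrm{pq}$), $$E(\rho,\theta)=-\sum_{i\in\mathrm{pv}\cup\mathrm{pq}}P_i\theta_i-\sum_{i\in\mathrm{pq}}Q_i\rho_i+\sum_{(i,j)\in\mathcal{E}}B_{ij}\frac{\exp(2\rho_i)+\exp(2\rho_j)}{2}-\sum_{(i,j)\in\mathcal{E}}B_{ij}\exp(\rho_i+\rho_j)\cos(\theta_{ij}).$$ Domain of convexity: $\mathcal{D}=\{(\rho,\theta):\nabla^2E(\alpha\rho,\alpha\theta)\succeq0\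 \ \forall\alpha\in[0,1]\}$. Matrix notation: for an index set $T$, $[a]_{ii}^{T}$ is the $|T|\times|T|$ matrix (rows and columns indexed by $T$) with $(i,i)$ entry $a$ and all other entries $0$; $\left[\begin{pmatrix}a&b\\c&d\end{pmatrix}\right]_{ij}^{T}$ is the $|T|\times|T|$ matrix $M$ with $M_{ii}=a$, $M_{ij}=b$, $M_{ji}=c$, $M_{jj}=d$ and all other entries $0$. $M\succeq0$ means positive semidefinite. The matrix inequality is understood to require $\cos(\theta_{ij})\neq0$ for every edge whose cosine appears in a denominator (edges with at least one endpoint in $\mathrm{pq}$); if $\mathrm{pq}=\emptyset$ it is vacuous.
   Formalization: Part (c) is stated for connected networks only: if some component does not contain s, shifting all its phases changes E affinely and preserves C, so E is not strictly convex whenever Int(C) is nonempty (e.g. V={s,a}, a in pv, no edges). *)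

theory Defs
  imports "HOL-Analysis.Analysis"
begin

section \<open>Networks\<close>

text \<open>
  The nodes are the elements of a finite type. The set \<open>edges\<close> contains exactly one of
  \<open>(i, j)\<close>, \<open>(j, i)\<close> for every edge of the simple graph, so it encodes both the graph and the
  chosen orientation.
\<close>

definition adj :: "('v \<times> 'v) set \<Rightarrow> 'v \<Rightarrow> 'v \<Rightarrow> bool" where
  "adj edges i j \<longleftrightarrow> (i, j) \<in> edges \<or> (j, i) \<in> edges"

locale power_network =
  fixes edges :: "('v::finite \<times> 'v) set"
    and B :: "'v \<Rightarrow> 'v \<Rightarrow> real"
    and pv pq :: "'v set"
    and s :: 'v
  assumes oriented: "(i, j) \<in> edges \<Longrightarrow> (j, i) \<notin> edges" \<comment> \<open>for \<open>i = j\<close>: no loops\<close>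
    and B_sym: "B i j = B j i"
    and B_pos: "adj edges i j \<Longrightarrow> B i j > 0"
    and B_zero: "\<not> adj edges i j \<Longrightarrow> B i j = 0"
    and nodes: "pv \<union> pq \<union> {s} = UNIV"
    and pv_pq_disjoint: "pv \<inter> pq = {}"
    and slack: "s \<notin> pv" "s \<notin> pq"

definition connected_network :: "('v \<times> 'v) set \<Rightarrow> bool" where
  "connected_network edges \<longleftrightarrow> (\<forall>i j. (i, j) \<in> (edges \<union> edges\<inverse>)\<^sup>*)"

text \<open>Cycles are those of the undirected graph; the orientation plays no role.\<close>

definition is_cycle :: "('v \<times> 'v) set \<Rightarrow> 'v list \<Rightarrow> bool" where
  "is_cycle edges vs \<longleftrightarrow> 3 \<le> length vs \<and> distinct vs \<and>
     (\<forall>k < length vs. adj edges (vs ! k) (vs ! ((k + 1) mod length vs)))"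

definition is_tree :: "('v \<times> 'v) set \<Rightarrow> bool" where
  "is_tree edges \<longleftrightarrow> connected_network edges \<and> (\<nexists>vs. is_cycle edges vs)"

definition nodal_B :: "('v \<times> 'v) set \<Rightarrow> ('v \<Rightarrow> 'v \<Rightarrow> real) \<Rightarrow> 'v \<Rightarrow> real" where
  "nodal_B edges B i = (\<Sum>j | adj edges j i. B i j)"


section \<open>Matrices indexed by a set\<close>

text \<open>
  A matrix with rows and columns indexed by \<open>T\<close> is a function of two indices of which only the
  values on \<open>T \<times> T\<close> are used.
\<close>

definition psd_on :: "'k set \<Rightarrow> ('k \<Rightarrow> 'k \<Rightarrow> real) \<Rightarrow> bool" where
  "psd_on T M \<longleftrightarrow> (\<forall>k\<in>T. \<forall>l\<in>T. M k l = M l k) \<and>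
     (\<forall>v. 0 \<le> (\<Sum>k\<in>T. \<Sum>l\<in>T. v k * M k l * v l))"

definition diag_entry :: "'k \<Rightarrow> real \<Rightarrow> 'k \<Rightarrow> 'k \<Rightarrow> real" where
  "diag_entry i a k l = (if k = i \<and> l = i then a else 0)"

definition block_entry ::
    "'k \<Rightarrow> 'k \<Rightarrow> real \<Rightarrow> real \<Rightarrow> real \<Rightarrow> real \<Rightarrow> 'k \<Rightarrow> 'k \<Rightarrow> real" where
  "block_entry i j a b c d k l =
     (if k = i \<and> l = i then a else if k = i \<and> l = j then b
      else if k = j \<and> l = i then c else if k = j \<and> l = j then d else 0)"


section \<open>States and free variables\<close>

type_synonym 'v state = "(real ^ 'v) \<times> (real ^ 'v)"

text \<open>
  A state \<open>(\<rho>, \<theta>)\<close> lists all log voltage magnitudes and phases, including the ones fixed to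
  zero. The states form a linear subspace, with the free variables as coordinates.
\<close>

definition states :: "'v set \<Rightarrow> 'v \<Rightarrow> 'v::finite state set" where
  "states pq s = {(\<rho>, \<theta>). (\<forall>i. i \<notin> pq \<longrightarrow> \<rho> $ i = 0) \<and> \<theta> $ s = 0}"

text \<open>\<open>Inl i\<close> stands for the variable \<open>\<rho>\<^sub>i\<close> and \<open>Inr i\<close> for \<open>\<theta>\<^sub>i\<close>.\<close>

definition free_vars :: "'v set \<Rightarrow> 'v set \<Rightarrow> ('v + 'v) set" where
  "free_vars pv pq = Inl ` pq \<union> Inr ` (pv \<union> pq)"

fun coord_dir :: "'v + 'v \<Rightarrow> 'v::finite state" where
  "coord_dir (Inl i) = (axis i 1, 0)"
| "coord_dir (Inr i) = (0, axis i 1)"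

definition partial_deriv :: "('v::finite state \<Rightarrow> real) \<Rightarrow> 'v + 'v \<Rightarrow> 'v state \<Rightarrow> real" where
  "partial_deriv f k x = deriv (\<lambda>t. f (x + t *\<^sub>R coord_dir k)) 0"

definition hessian :: "('v::finite state \<Rightarrow> real) \<Rightarrow> 'v state \<Rightarrow> 'v + 'v \<Rightarrow> 'v + 'v \<Rightarrow> real" where
  "hessian f x k l = partial_deriv (partial_deriv f l) k x"

definition strictly_convex_on :: "'a::real_vector set \<Rightarrow> ('a \<Rightarrow> real) \<Rightarrow> bool" where
  "strictly_convex_on S f \<longleftrightarrow> convex S \<and>
     (\<forall>x\<in>S. \<forall>y\<in>S. x \<noteq> y \<longrightarrow>
       (\<forall>u>0. \<forall>v>0. u + v = 1 \<longrightarrow> f (u *\<^sub>R x + v *\<^sub>R y) < u * f x + v * f y))"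


section \<open>Energy function and convexity domains\<close>

definition energy :: "('v::finite \<times> 'v) set \<Rightarrow> ('v \<Rightarrow> 'v \<Rightarrow> real) \<Rightarrow> 'v set \<Rightarrow> 'v set \<Rightarrow>
    ('v \<Rightarrow> real) \<Rightarrow> ('v \<Rightarrow> real) \<Rightarrow> 'v state \<Rightarrow> real" where
  "energy edges B pv pq P Q = (\<lambda>(\<rho>, \<theta>).
     - (\<Sum>i\<in>pv \<union> pq. P i * \<theta> $ i) - (\<Sum>i\<in>pq. Q i * \<rho> $ i)
     + (\<Sum>(i, j)\<in>edges. B i j * ((exp (2 * \<rho> $ i) + exp (2 * \<rho> $ j)) / 2))
     - (\<Sum>(i, j)\<in>edges. B i j * exp (\<rho> $ i + \<rho> $ j) * cos (\<theta> $ i - \<theta> $ j)))"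

definition domain_D :: "('v::finite \<times> 'v) set \<Rightarrow> ('v \<Rightarrow> 'v \<Rightarrow> real) \<Rightarrow> 'v set \<Rightarrow> 'v set \<Rightarrow> 'v \<Rightarrow>
    ('v \<Rightarrow> real) \<Rightarrow> ('v \<Rightarrow> real) \<Rightarrow> 'v state set" where
  "domain_D edges B pv pq s P Q = {x \<in> states pq s. \<forall>\<alpha>\<in>{0..1}.
     psd_on (free_vars pv pq) (hessian (energy edges B pv pq P Q) (\<alpha> *\<^sub>R x))}"

definition C_matrix :: "('v::finite \<times> 'v) set \<Rightarrow> ('v \<Rightarrow> 'v \<Rightarrow> real) \<Rightarrow> 'v set \<Rightarrow> 'v set \<Rightarrow> 'v \<Rightarrow>
    'v state \<Rightarrow> 'v \<Rightarrow> 'v \<Rightarrow> real" where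
  "C_matrix edges B pv pq s = (\<lambda>(\<rho>, \<theta>) k l.
     (\<Sum>i\<in>pq. diag_entry i
        (2 * nodal_B edges B i
          - (\<Sum>j\<in>pv \<union> {s}. B i j * (exp (\<rho> $ j - \<rho> $ i) / cos (\<theta> $ j - \<theta> $ i)))) k l)
     - (\<Sum>(i, j)\<in>{(i, j) \<in> edges. i \<in> pq \<and> j \<in> pq}. B i j / cos (\<theta> $ i - \<theta> $ j) *
          block_entry i j (exp (\<rho> $ j - \<rho> $ i)) 1 1 (exp (\<rho> $ i - \<rho> $ j)) k l))"

text \<open>
  Division by zero yields zero in HOL, so the denominators occurring in the matrix are required
  to be nonzero explicitly. Terms for non-adjacent \<open>i\<close>, \<open>j\<close> vanish because \<open>B i j = 0\<close>.
\<close>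

definition set_C :: "('v::finite \<times> 'v) set \<Rightarrow> ('v \<Rightarrow> 'v \<Rightarrow> real) \<Rightarrow> 'v set \<Rightarrow> 'v set \<Rightarrow> 'v \<Rightarrow>
    'v state set" where
  "set_C edges B pv pq s = {(\<rho>, \<theta>) \<in> states pq s.
     (\<forall>(i, j)\<in>edges. \<bar>\<theta> $ i - \<theta> $ j\<bar> \<le> pi / 2) \<and>
     (\<forall>(i, j)\<in>edges. i \<in> pq \<or> j \<in> pq \<longrightarrow> cos (\<theta> $ i - \<theta> $ j) \<noteq> 0) \<and>
     psd_on pq (C_matrix edges B pv pq s (\<rho>, \<theta>))}"

text \<open>
  The interior is taken in the space of free variables: in the ambient space of all pairs, the
  proper subspace \<open>states pq s\<close> has empty interior.
\<close>

definition int_C :: "('v::finite \<times> 'v) set \<Rightarrow> ('v \<Rightarrow> 'v \<Rightarrow> real) \<Rightarrow> 'v set \<Rightarrow> 'v set \<Rightarrow> 'v \<Rightarrow>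
    'v state set" where
  "int_C edges B pv pq s = (top_of_set (states pq s)) interior_of (set_C edges B pv pq s)"

end

theory Submission
  imports Defs
begin

text \<open>
  Everything follows from one completed square. Let \<open>h = (u, w)\<close> be a direction and put
  \<open>v\<^sub>i = exp \<rho>\<^sub>i * u\<^sub>i\<close>. For an edge \<open>(i, j)\<close> with \<open>cos \<theta>\<^sub>i\<^sub>j \<noteq> 0\<close>, the second derivative of its
  energy splits as the edge's share of the quadratic form of the matrix defining the convex set
  at \<open>v\<close>, plus \<open>exp (\<rho>\<^sub>i + \<rho>\<^sub>j) * cos \<theta>\<^sub>i\<^sub>j\<close> times the square of
  \<open>(w\<^sub>i - w\<^sub>j) + (u\<^sub>i + u\<^sub>j) * tan \<theta>\<^sub>i\<^sub>j\<close> (\<open>edge_hess_complete_square\<close>, summed up in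
  \<open>hess_form_eq\<close>). So the matrix is a kind of Schur complement of the Hessian with respect to the
  phases: once all cosines are nonnegative, its semidefiniteness implies that of the Hessian.

  The set is convex because the off-diagonal entries \<open>- B\<^sub>i\<^sub>j / cos \<theta>\<^sub>i\<^sub>j\<close> are nonpositive. The form
  therefore decreases when \<open>v\<close> is replaced by its absolute value, so only \<open>v \<ge> 0\<close> has to be
  tested, and for a fixed \<open>v \<ge> 0\<close> the form is concave in \<open>(\<rho>, \<theta>)\<close>, because
  \<open>exp r / cos t = exp (r - ln (cos t))\<close> is jointly convex (\<open>voltage_form_abs_le\<close>,
  \<open>voltage_form_concave\<close>). The origin satisfies the condition, hence so do all multiples \<open>\<alpha> x\<close>
  with \<open>\<alpha> \<in> [0, 1]\<close>, which gives the inclusion in the domain of convexity; convexity of the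
  energy follows by integrating the second derivative along segments.

  On a tree the differences \<open>w\<^sub>i - w\<^sub>j\<close> can be prescribed independently on all edges
  (\<open>forest_potential\<close>). Directions concentrated on one edge force the phase condition and exclude
  vanishing cosines, and the choice that makes every completed square zero turns semidefiniteness
  of the Hessian back into that of the matrix.

  In the interior the matrix is positive definite: a null vector \<open>v\<close> would make the form zero at
  \<open>\<bar>v\<bar>\<close>, and moving a single phase \<open>\<theta>\<^sub>k\<close> with \<open>v\<^sub>k \<noteq> 0\<close> both ways would make it negative on one
  side, as \<open>1 / cos\<close> is strictly convex (\<open>voltage_form_pos\<close>). A direction of zero curvature thus has
  \<open>u = 0\<close>, and then \<open>w\<close> is constant along edges, so it vanishes because \<open>w\<^sub>s = 0\<close> and the network
  is connected.
\<close>

section \<open>Energy of a single edge\<close>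

definition edge_energy :: "'v::finite state \<Rightarrow> 'v \<Rightarrow> 'v \<Rightarrow> real" where
  "edge_energy x i j = (exp (2 * fst x $ i) + exp (2 * fst x $ j)) / 2
     - exp (fst x $ i + fst x $ j) * cos (snd x $ i - snd x $ j)"

text \<open>\<open>edge_grad\<close> and \<open>edge_hess\<close> are the directional derivatives of \<open>edge_energy\<close>.\<close>

definition edge_grad :: "'v::finite state \<Rightarrow> 'v state \<Rightarrow> 'v \<Rightarrow> 'v \<Rightarrow> real" where
  "edge_grad x h i j =
     exp (2 * fst x $ i) * fst h $ i + exp (2 * fst x $ j) * fst h $ j
     - exp (fst x $ i + fst x $ j) *
       ((fst h $ i + fst h $ j) * cos (snd x $ i - snd x $ j)
        - (snd h $ i - snd h $ j) * sin (snd x $ i - snd x $ j))"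

definition edge_hess :: "'v::finite state \<Rightarrow> 'v state \<Rightarrow> 'v state \<Rightarrow> 'v \<Rightarrow> 'v \<Rightarrow> real" where
  "edge_hess x h k i j =
     2 * exp (2 * fst x $ i) * (fst h $ i * fst k $ i)
     + 2 * exp (2 * fst x $ j) * (fst h $ j * fst k $ j)
     - exp (fst x $ i + fst x $ j) *
       (((fst h $ i + fst h $ j) * (fst k $ i + fst k $ j)
          - (snd h $ i - snd h $ j) * (snd k $ i - snd k $ j)) * cos (snd x $ i - snd x $ j)
        - ((fst h $ i + fst h $ j) * (snd k $ i - snd k $ j)
          + (snd h $ i - snd h $ j) * (fst k $ i + fst k $ j)) * sin (snd x $ i - snd x $ j))"

text \<open>
  The share of one edge, divided by \<open>B\<^sub>i\<^sub>j\<close>, in the quadratic form of the matrix defining the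
  convex set, evaluated at a vector \<open>v\<close> that vanishes off \<open>pq\<close>: then \<open>\<Sum>\<^sub>i 2 B\<^sub>i v\<^sub>i\<^sup>2\<close> distributes over the edges, and
  the same formula covers edges with one or two endpoints in \<open>pq\<close>.
\<close>

definition edge_voltage :: "'v::finite state \<Rightarrow> ('v \<Rightarrow> real) \<Rightarrow> 'v \<Rightarrow> 'v \<Rightarrow> real" where
  "edge_voltage x v i j = 2 * (v i)\<^sup>2 + 2 * (v j)\<^sup>2
     - ((v i)\<^sup>2 * exp (fst x $ j - fst x $ i) + 2 * v i * v j
        + (v j)\<^sup>2 * exp (fst x $ i - fst x $ j)) / cos (snd x $ i - snd x $ j)"

lemma edge_energy_deriv:
  "((\<lambda>t. edge_energy (x + t *\<^sub>R h) i j) has_real_derivative edge_grad (x + t *\<^sub>R h) h i j) (at t)"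
  unfolding edge_energy_def edge_grad_def
  by (auto intro!: derivative_eq_intros simp: algebra_simps)

lemma edge_grad_deriv:
  "((\<lambda>t. edge_grad (x + t *\<^sub>R k) h i j) has_real_derivative edge_hess (x + t *\<^sub>R k) h k i j) (at t)"
  unfolding edge_grad_def edge_hess_def
  by (auto intro!: derivative_eq_intros simp: algebra_simps)

lemma edge_hess_sym: "edge_hess x h k i j = edge_hess x k h i j"
  by (simp add: edge_hess_def algebra_simps)

lemma edge_hess_add: "edge_hess x (h + h') k i j = edge_hess x h k i j + edge_hess x h' k i j"
  by (simp add: edge_hess_def algebra_simps)

lemma edge_hess_scale: "edge_hess x (c *\<^sub>R h) k i j = c * edge_hess x h k i j"
  by (simp add: edge_hess_def algebra_simps)

text \<open>
  For \<open>h = (u, w)\<close>, \<open>s = u\<^sub>i + u\<^sub>j\<close> and \<open>d = w\<^sub>i - w\<^sub>j\<close>, the part of the second derivative with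
  factor \<open>exp (\<rho>\<^sub>i + \<rho>\<^sub>j)\<close> is \<open>cos \<theta> d\<^sup>2 + 2 sin \<theta> s d - cos \<theta> s\<^sup>2\<close>; completing the square
  in \<open>d\<close> leaves \<open>- s\<^sup>2 / cos \<theta>\<close>, since
  \<open>cos \<theta> + sin\<^sup>2 \<theta> / cos \<theta> = 1 / cos \<theta>\<close>.
\<close>

lemma edge_hess_complete_square:
  assumes c: "cos (snd x $ i - snd x $ j) \<noteq> 0"
  shows "edge_hess x h h i j = edge_voltage x (\<lambda>i. exp (fst x $ i) * fst h $ i) i j
    + exp (fst x $ i + fst x $ j) * cos (snd x $ i - snd x $ j) *
      (snd h $ i - snd h $ j + (fst h $ i + fst h $ j) * tan (snd x $ i - snd x $ j))\<^sup>2"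
proof -
  define a b u v d where "a = exp (fst x $ i)" "b = exp (fst x $ j)"
    and "u = fst h $ i" "v = fst h $ j" "d = snd h $ i - snd h $ j"
  define co si where "co = cos (snd x $ i - snd x $ j)" "si = sin (snd x $ i - snd x $ j)"
  have si: "si\<^sup>2 = 1 - co\<^sup>2"
    unfolding co_si_def by (simp add: sin_squared_eq)
  have pos: "a > 0" "b > 0" by (auto simp: a_b_def)
  have ex: "exp (2 * fst x $ i) = a^2" "exp (2 * fst x $ j) = b^2" "exp (fst x $ i + fst x $ j) = a * b"
     "exp (fst x $ i - fst x $ j) = a / b" "exp (fst x $ j - fst x $ i) = b / a"
    by (simp_all add: a_b_def exp_add exp_diff exp_double)
  have "co * (2 * a^2 * (u * u) + 2 * b^2 * (v * v)
       - (a * b) * (((u + v) * (u + v) - d * d) * co - ((u + v) * d + d * (u + v)) * si))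
     = co * (2 * (a * u)^2 + 2 * (b * v)^2) - ((a * u)^2 * (b / a) + 2 * (a * u) * (b * v) + (b * v)^2 * (a / b))
       + (a * b) * (d * co + (u + v) * si)^2"
  proof -
    have "(a * u)^2 * (b / a) = a * b * u^2" "(b * v)^2 * (a / b) = a * b * v^2"
      using pos by (simp_all add: power2_eq_square field_simps)
    moreover have "(d * co + (u + v) * si)^2 = d^2 * co^2 + 2 * d * co * (u + v) * si + (u + v)^2 * si^2"
      by (simp add: power2_eq_square algebra_simps)
    ultimately show ?thesis unfolding si by (simp only:) (simp add: power2_eq_square algebra_simps)
  qed
  then have "2 * a^2 * (u * u) + 2 * b^2 * (v * v)
       - (a * b) * (((u + v) * (u + v) - d * d) * co - ((u + v) * d + d * (u + v)) * si)
     = (2 * (a * u)^2 + 2 * (b * v)^2) - ((a * u)^2 * (b / a) + 2 * (a * u) * (b * v) + (b * v)^2 * (a / b)) / co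
       + (a * b) * co * (d + (u + v) * (si / co))^2"
    using c[folded co_si_def] by (simp add: field_simps power2_eq_square)
  then show ?thesis
    by (simp only: edge_hess_def edge_voltage_def tan_def ex a_b_def[symmetric] u_v_d_def[symmetric] co_si_def[symmetric])
qed

section \<open>Convexity of exp r / cos t\<close>

lemma neg_ln_cos_convex: "convex_on {- (pi / 2)<..<pi / 2} (\<lambda>t. - ln (cos t))"
proof (rule f''_ge0_imp_convex)
  show "convex {- (pi / 2)<..<pi / 2}" by simp
next
  fix t assume t: "t \<in> {- (pi / 2)<..<pi / 2}"
  then have c: "cos t > 0" by (simp add: cos_gt_zero_pi)
  show "((\<lambda>t. - ln (cos t)) has_real_derivative tan t) (at t)"
    using c by (auto intro!: derivative_eq_intros simp: tan_def field_simps)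
  show "(tan has_real_derivative inverse ((cos t)\<^sup>2)) (at t)"
    using c by (intro DERIV_tan) auto
  show "inverse ((cos t)\<^sup>2) \<ge> 0" by simp
qed

text \<open>Convexity in both variables jointly, from \<open>exp r / cos t = exp (r - ln (cos t))\<close>.\<close>

lemma exp_over_cos_convex:
  fixes a b r r' t t' :: real
  assumes t: "\<bar>t\<bar> < pi / 2" "\<bar>t'\<bar> < pi / 2" and a: "0 \<le> a" "0 \<le> b" "a + b = 1"
  shows "exp (a * r + b * r') / cos (a * t + b * t') \<le> a * (exp r / cos t) + b * (exp r' / cos t')"
proof -
  have tin: "t \<in> {- (pi / 2)<..<pi / 2}" "t' \<in> {- (pi / 2)<..<pi / 2}"
    using t by (auto simp: abs_less_iff)
  have m: "a * t + b * t' \<in> {- (pi / 2)<..<pi / 2}"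
    using convexD[OF _ tin a] by simp
  have L: "- ln (cos (a * t + b * t')) \<le> a * (- ln (cos t)) + b * (- ln (cos t'))"
    using conjunct2[OF neg_ln_cos_convex[unfolded convex_on_def], rule_format, OF tin a] by simp
  have e: "exp r / cos t = exp (r - ln (cos t))" if "\<bar>t\<bar> < pi / 2" for r t
    using that cos_gt_zero_pi[of t] by (simp add: exp_diff abs_less_iff)
  have "exp (a * r + b * r') / cos (a * t + b * t')
      = exp (a * r + b * r' - ln (cos (a * t + b * t')))"
    using m by (intro e) (unfold greaterThanLessThan_iff, arith)
  also have "\<dots> \<le> exp (a * (r - ln (cos t)) + b * (r' - ln (cos t')))"
    using L by (simp add: algebra_simps)
  also have "\<dots> \<le> a * exp (r - ln (cos t)) + b * exp (r' - ln (cos t'))"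
    using exp_convex a unfolding convex_on_def by simp
  finally show ?thesis using e t by simp
qed

lemma abs_less_of_cos: "\<bar>t\<bar> \<le> pi / 2 \<Longrightarrow> cos t \<noteq> 0 \<Longrightarrow> \<bar>t\<bar> < pi / 2" for t :: real
  by (metis cos_abs_real cos_pi_half order_le_less)

text \<open>This is the harmonic-arithmetic mean inequality, as the two cosines have mean \<open>cos t * cos e\<close>.\<close>

lemma inverse_cos_strict_midpoint:
  fixes t e :: real
  assumes c: "cos t > 0" "cos (t + e) > 0" "cos (t - e) > 0" and e: "0 < e" "e \<le> 1"
  shows "2 / cos t < 1 / cos (t + e) + 1 / cos (t - e)"
proof -
  let ?a = "cos (t + e)" and ?b = "cos (t - e)"
  have "cos e < cos 0" using cos_monotone_0_pi[of 0 e] e pi_gt3 by linarith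
  then have "cos t * cos e < cos t" using c by simp
  then have s: "?a + ?b < 2 * cos t" by (simp add: cos_add cos_diff mult.commute)
  have "4 * (?a * ?b) \<le> (?a + ?b) * (?a + ?b)"
    using zero_le_power2[of "?a - ?b"] by (simp add: power2_eq_square algebra_simps)
  then have "4 / (?a + ?b) \<le> (?a + ?b) / (?a * ?b)"
    using c by (simp add: divide_simps)
  also have "\<dots> = 1 / ?a + 1 / ?b"
    using c by (simp add: add_divide_distrib)
  finally have "4 / (?a + ?b) \<le> 1 / ?a + 1 / ?b" .
  moreover have "2 / cos t < 4 / (?a + ?b)"
    using s c by (simp add: divide_simps)
  ultimately show ?thesis by linarith
qed

text \<open>The slopes on the two sides of \<open>t\<close> are values of the strictly increasing derivative.\<close>

lemma pos_second_derivative_strict: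
  fixes f :: "real \<Rightarrow> real"
  assumes f: "\<And>t. (f has_real_derivative f' t) (at t)"
    and f': "\<And>t. (f' has_real_derivative f'' t) (at t)"
    and pos: "\<And>t. 0 \<le> t \<Longrightarrow> t \<le> 1 \<Longrightarrow> f'' t > 0"
    and t: "0 < t" "t < 1"
  shows "f t < (1 - t) * f 0 + t * f 1"
proof -
  obtain a where a: "0 < a" "a < t" "f t - f 0 = (t - 0) * f' a"
    using MVT2[of 0 t f f'] t f by blast
  obtain b where b: "t < b" "b < 1" "f 1 - f t = (1 - t) * f' b"
    using MVT2[of t 1 f f'] t f by blast
  have "f' a < f' b"
    using a b t by (intro DERIV_pos_imp_increasing[of a b f']) (auto intro!: exI[of _ "f'' _"] f' pos)
  then have "t * (1 - t) * (f' a - f' b) < 0"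
    using t by (simp add: mult_pos_neg)
  moreover have "f t - ((1 - t) * f 0 + t * f 1) = (1 - t) * (f t - f 0) - t * (f 1 - f t)"
    by (simp add: algebra_simps)
  moreover have "\<dots> = t * (1 - t) * (f' a - f' b)"
    unfolding a(3) b(3) by (simp add: algebra_simps)
  ultimately show ?thesis by linarith
qed

text \<open>Nonnegativity of \<open>v\<close> is what makes the mixed term \<open>- 2 v\<^sub>i v\<^sub>j / cos \<theta>\<^sub>i\<^sub>j\<close> concave.\<close>

lemma edge_voltage_concave:
  assumes t: "\<bar>snd x $ i - snd x $ j\<bar> < pi / 2" "\<bar>snd y $ i - snd y $ j\<bar> < pi / 2"
    and v: "0 \<le> v i" "0 \<le> v j" and ab: "0 \<le> a" "0 \<le> b" "a + b = 1"
  shows "a * edge_voltage x v i j + b * edge_voltage y v i j \<le> edge_voltage (a *\<^sub>R x + b *\<^sub>R y) v i j"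
proof -
  let ?z = "a *\<^sub>R x + b *\<^sub>R y"
  let ?c = "\<lambda>x. cos (snd x $ i - snd x $ j)"
  have cz: "?c ?z = cos (a * (snd x $ i - snd x $ j) + b * (snd y $ i - snd y $ j))"
    by (simp add: algebra_simps)
  have conv: "exp (r ?z) / ?c ?z \<le> a * (exp (r x) / ?c x) + b * (exp (r y) / ?c y)"
    if "r ?z = a * r x + b * r y" for r
    unfolding cz that using t ab by (rule exp_over_cos_convex)
  let ?p = "\<lambda>x. exp (fst x $ j - fst x $ i) / ?c x" and ?q = "\<lambda>x. 1 / ?c x"
    and ?r = "\<lambda>x. exp (fst x $ i - fst x $ j) / ?c x"
  have p: "?p ?z \<le> a * ?p x + b * ?p y" by (rule conv) (simp add: algebra_simps)
  have q: "?q ?z \<le> a * ?q x + b * ?q y" using conv[of "\<lambda>_. 0"] by simp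
  have r: "?r ?z \<le> a * ?r x + b * ?r y" by (rule conv) (simp add: algebra_simps)
  have eq: "edge_voltage x v i j = 2 * (v i)\<^sup>2 + 2 * (v j)\<^sup>2 - ((v i)\<^sup>2 * ?p x + 2 * (v i * v j) * ?q x + (v j)\<^sup>2 * ?r x)" for x
    by (simp add: edge_voltage_def add_divide_distrib)
  have le: "(v i)\<^sup>2 * ?p ?z + 2 * (v i * v j) * ?q ?z + (v j)\<^sup>2 * ?r ?z
    \<le> (v i)\<^sup>2 * (a * ?p x + b * ?p y) + 2 * (v i * v j) * (a * ?q x + b * ?q y) + (v j)\<^sup>2 * (a * ?r x + b * ?r y)"
    using v by (intro add_mono mult_left_mono p q r) auto
  have "a * (k - (c * p + d * q + e * r)) + b * (k - (c * p' + d * q' + e * r'))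
      = (a + b) * k - (c * (a * p + b * p') + d * (a * q + b * q') + e * (a * r + b * r'))"
    for k c d e p q r p' q' r' :: real
    by (simp add: algebra_simps)
  then show ?thesis unfolding eq ab(3) using le by (simp only: mult_1_left diff_left_mono)
qed

section \<open>Potentials on a forest\<close>

lemma rtrancl_distinct_path:
  assumes "(a, b) \<in> R\<^sup>*"
  shows "\<exists>vs. vs \<noteq> [] \<and> hd vs = a \<and> last vs = b \<and> distinct vs \<and> successively (\<lambda>x y. (x, y) \<in> R) vs"
  using assms
proof (induction rule: rtrancl_induct)
  case base
  show ?case by (intro exI[of _ "[a]"]) auto
next
  case (step y z)
  then obtain vs where vs: "vs \<noteq> []" "hd vs = a" "last vs = y" "distinct vs"
    "successively (\<lambda>x y. (x, y) \<in> R) vs" by blast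
  show ?case
  proof (cases "z \<in> set vs")
    case True
    then obtain xs ys where "vs = xs @ z # ys" by (meson split_list)
    with vs show ?thesis
      by (intro exI[of _ "xs @ [z]"]) (auto simp: successively_append_iff hd_append split: if_splits)
  next
    case False
    with vs step show ?thesis
      by (intro exI[of _ "vs @ [z]"]) (auto simp: successively_append_iff)
  qed
qed

lemma is_cycle_mono: "is_cycle F vs \<Longrightarrow> F \<subseteq> G \<Longrightarrow> is_cycle G vs"
  unfolding is_cycle_def adj_def by blast

text \<open>The bound of three vertices holds because neither orientation of the edge lies in \<open>F\<close>.\<close>

lemma edge_closes_cycle:
  assumes path: "(a, b) \<in> (F \<union> F\<inverse>)\<^sup>*" and ab: "(a, b) \<notin> F" "(b, a) \<notin> F" "a \<noteq> b"
  shows "\<exists>vs. is_cycle (insert (a, b) F) vs"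
proof -
  obtain vs where vs: "vs \<noteq> []" "hd vs = a" "last vs = b" "distinct vs"
    "successively (\<lambda>x y. (x, y) \<in> F \<union> F\<inverse>) vs"
    using rtrancl_distinct_path[OF path] by blast
  have nth: "(vs ! k, vs ! Suc k) \<in> F \<union> F\<inverse>" if "Suc k < length vs" for k
    using vs(5) that by (simp add: successively_conv_nth)
  have ends: "vs ! 0 = a" "vs ! (length vs - 1) = b"
    using vs by (simp_all add: hd_conv_nth last_conv_nth)
  have "length vs \<noteq> 0" "length vs \<noteq> 1" using vs(1) ends ab by auto
  moreover have "length vs \<noteq> 2" using nth[of 0] ends ab by auto
  ultimately have "3 \<le> length vs" by linarith
  moreover have "adj (insert (a, b) F) (vs ! k) (vs ! ((k + 1) mod length vs))" if "k < length vs" for k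
  proof (cases "Suc k < length vs")
    case True
    with nth[OF this] show ?thesis by (auto simp: adj_def)
  next
    case False
    with that have "k = length vs - 1" "(k + 1) mod length vs = 0"
      by (simp_all add: not_less less_eq_Suc_le)
    with ends show ?thesis by (simp add: adj_def)
  qed
  ultimately show ?thesis using vs(4) unfolding is_cycle_def by blast
qed

text \<open>
  Any prescribed differences along the edges of a forest come from a potential. In the induction
  on the edges, a new edge joins two components, and the potential can be shifted on one of them.
\<close>

lemma forest_potential:
  fixes d :: "'v \<Rightarrow> 'v \<Rightarrow> real"
  assumes "finite F" "\<And>i j. (i, j) \<in> F \<Longrightarrow> (j, i) \<notin> F" "\<nexists>vs. is_cycle F vs"
  shows "\<exists>w. \<forall>(i, j)\<in>F. w i - w j = d i j"
  using assms
proof (induction F rule: finite_induct)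
  case empty
  show ?case by simp
next
  case (insert e F)
  obtain a b where e: "e = (a, b)" by fastforce
  have "\<nexists>vs. is_cycle F vs" using insert.prems(2) is_cycle_mono by blast
  moreover have "\<And>i j. (i, j) \<in> F \<Longrightarrow> (j, i) \<notin> F" using insert.prems(1) by blast
  ultimately obtain w where w: "\<forall>(i, j)\<in>F. w i - w j = d i j" using insert.IH by blast
  define A where "A = {i. (a, i) \<in> (F \<union> F\<inverse>)\<^sup>*}"
  have "b \<notin> A"
    using edge_closes_cycle[of a b F] insert e unfolding A_def by blast
  have closed: "i \<in> A \<longleftrightarrow> j \<in> A" if "(i, j) \<in> F" for i j
    using that rtrancl_into_rtrancl[of a i "F \<union> F\<inverse>" j] rtrancl_into_rtrancl[of a j "F \<union> F\<inverse>" i]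
    unfolding A_def by auto
  have "a \<in> A" by (simp add: A_def)
  define w' where "w' i = (if i \<in> A then w i + (d a b - w a + w b) else w i)" for i
  have "w' i - w' j = d i j" if "(i, j) \<in> insert e F" for i j
  proof (cases "(i, j) = (a, b)")
    case True
    then show ?thesis using \<open>a \<in> A\<close> \<open>b \<notin> A\<close> by (simp add: w'_def)
  next
    case False
    then have "(i, j) \<in> F" using that e by auto
    with w closed[OF this] show ?thesis by (auto simp: w'_def)
  qed
  then show ?case by blast
qed

section \<open>States and interiors relative to a subspace\<close>

lemma mem_states:
  "x \<in> states pq s \<longleftrightarrow> (\<forall>i. i \<notin> pq \<longrightarrow> fst x $ i = 0) \<and> snd x $ s = 0"
  by (auto simp: states_def split_def)

lemma subspace_states: "subspace (states pq s)"
  by (auto simp: subspace_def mem_states)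

lemma segment_eq: "(1 - t) *\<^sub>R x + t *\<^sub>R y = x + t *\<^sub>R (y - x)" for x y :: "'a::real_vector"
  by (simp add: algebra_simps)

lemma mem_interior_of_subspace_iff:
  fixes S :: "'a::real_normed_vector set"
  assumes "C \<subseteq> S"
  shows "x \<in> top_of_set S interior_of C \<longleftrightarrow>
    x \<in> S \<and> (\<exists>e>0. \<forall>y\<in>S. dist y x < e \<longrightarrow> y \<in> C)"
proof
  assume "x \<in> top_of_set S interior_of C"
  then obtain T where T: "openin (top_of_set S) T" "x \<in> T" "T \<subseteq> C"
    by (auto simp: interior_of_def)
  then have "x \<in> S" using assms by blast
  moreover obtain e where "e > 0" "\<forall>y\<in>S. dist y x < e \<longrightarrow> y \<in> T"
    using T(1,2) unfolding openin_euclidean_subtopology_iff by blast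
  ultimately show "x \<in> S \<and> (\<exists>e>0. \<forall>y\<in>S. dist y x < e \<longrightarrow> y \<in> C)" using T(3) by blast
next
  assume "x \<in> S \<and> (\<exists>e>0. \<forall>y\<in>S. dist y x < e \<longrightarrow> y \<in> C)"
  then obtain e where e: "x \<in> S" "e > 0" "\<forall>y\<in>S. dist y x < e \<longrightarrow> y \<in> C" by blast
  have "openin (top_of_set S) (S \<inter> ball x e)" by (simp add: openin_open_Int)
  moreover have "x \<in> S \<inter> ball x e" using e by simp
  moreover have "S \<inter> ball x e \<subseteq> C" using e by (auto simp: dist_commute)
  ultimately show "x \<in> top_of_set S interior_of C" unfolding interior_of_def by blast
qed

lemma convex_interior_of_subspace:
  fixes S :: "'a::real_normed_vector set"
  assumes S: "subspace S" and C: "convex C" "C \<subseteq> S"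
  shows "convex (top_of_set S interior_of C)"
proof (rule convexI)
  fix x y and a b :: real
  assume xy: "x \<in> top_of_set S interior_of C" "y \<in> top_of_set S interior_of C"
    and ab: "0 \<le> a" "0 \<le> b" "a + b = 1"
  obtain d where d: "x \<in> S" "d > 0" "\<And>z. z \<in> S \<Longrightarrow> dist z x < d \<Longrightarrow> z \<in> C"
    using xy(1) mem_interior_of_subspace_iff[OF C(2)] by blast
  obtain e where e: "y \<in> S" "e > 0" "\<And>z. z \<in> S \<Longrightarrow> dist z y < e \<Longrightarrow> z \<in> C"
    using xy(2) mem_interior_of_subspace_iff[OF C(2)] by blast
  let ?m = "a *\<^sub>R x + b *\<^sub>R y"
  have m: "?m \<in> S" using S d e by (simp add: subspace_add subspace_scale)
  have "z \<in> C" if z: "z \<in> S" "dist z ?m < min d e" for z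
  proof -
    have "z - ?m \<in> S" using S z m by (simp add: subspace_diff)
    then have "x + (z - ?m) \<in> C" "y + (z - ?m) \<in> C"
      using z(2) S d(1) e(1) by (simp_all add: d(3) e(3) subspace_add dist_norm)
    then have "a *\<^sub>R (x + (z - ?m)) + b *\<^sub>R (y + (z - ?m)) \<in> C"
      using C(1) ab by (simp add: convexD)
    moreover have "a *\<^sub>R (x + (z - ?m)) + b *\<^sub>R (y + (z - ?m)) = ?m + (a + b) *\<^sub>R (z - ?m)"
      by (simp only: scaleR_add_right scaleR_add_left add_ac)
    ultimately show ?thesis using ab by simp
  qed
  moreover have "0 < min d e" using d e by simp
  ultimately show "?m \<in> top_of_set S interior_of C"
    unfolding mem_interior_of_subspace_iff[OF C(2)] using m by blast
qed

section \<open>Quadratic forms of a network\<close>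

lemma block_quadratic_form:
  assumes "finite T" "i \<in> T" "j \<in> T" "i \<noteq> j"
  shows "(\<Sum>k\<in>T. \<Sum>l\<in>T. v k * block_entry i j a b c d k l * v l)
    = (v i)\<^sup>2 * a + v i * v j * (b + c) + (v j)\<^sup>2 * (d::real)"
proof -
  have "(\<Sum>l\<in>T. v k * block_entry i j a b c d k l * v l)
     = (if k = i then v i * (a * v i + b * v j) else 0) + (if k = j then v j * (c * v i + d * v j) else 0)" for k
  proof -
    have "v k * block_entry i j a b c d k l * v l
      = (if l = i then (if k = i then v i * a * v i else 0) + (if k = j then v j * c * v i else 0) else 0)
      + (if l = j then (if k = i then v i * b * v j else 0) + (if k = j then v j * d * v j else 0) else 0)" for l
      using assms(4) by (auto simp: block_entry_def)
    then show ?thesis using assms by (simp add: sum.distrib sum.delta algebra_simps)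
  qed
  then show ?thesis using assms by (simp add: sum.distrib sum.delta algebra_simps power2_eq_square)
qed

context
  fixes edges :: "('v::finite \<times> 'v) set"
    and B :: "'v \<Rightarrow> 'v \<Rightarrow> real"
    and pv pq :: "'v set"
    and s :: 'v
  assumes network: "power_network edges B pv pq s"
begin

interpretation power_network edges B pv pq s
  by (rule network)

definition hess_form :: "'v state \<Rightarrow> 'v state \<Rightarrow> 'v state \<Rightarrow> real" where
  "hess_form x h k = (\<Sum>(i, j)\<in>edges. B i j * edge_hess x h k i j)"

definition voltage_form :: "'v state \<Rightarrow> ('v \<Rightarrow> real) \<Rightarrow> real" where
  "voltage_form x v = (\<Sum>(i, j)\<in>edges. B i j * edge_voltage x v i j)"

text \<open>The completed squares in the phase differences that remain beside \<open>voltage_form\<close>.\<close>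

definition phase_form :: "'v state \<Rightarrow> 'v state \<Rightarrow> real" where
  "phase_form x h = (\<Sum>(i, j)\<in>edges. B i j * (exp (fst x $ i + fst x $ j) * cos (snd x $ i - snd x $ j) *
      (snd h $ i - snd h $ j + (fst h $ i + fst h $ j) * tan (snd x $ i - snd x $ j))\<^sup>2))"

definition energy_grad :: "('v \<Rightarrow> real) \<Rightarrow> ('v \<Rightarrow> real) \<Rightarrow> 'v state \<Rightarrow> 'v state \<Rightarrow> real" where
  "energy_grad P Q x h = - (\<Sum>i\<in>pv \<union> pq. P i * snd h $ i) - (\<Sum>i\<in>pq. Q i * fst h $ i)
     + (\<Sum>(i, j)\<in>edges. B i j * edge_grad x h i j)"

lemma edge_neq: "(i, j) \<in> edges \<Longrightarrow> i \<noteq> j"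
  using oriented by blast

lemma edge_B_pos: "(i, j) \<in> edges \<Longrightarrow> B i j > 0"
  by (simp add: B_pos adj_def)

lemma not_pq_iff: "i \<notin> pq \<longleftrightarrow> i \<in> pv \<or> i = s"
  using nodes pv_pq_disjoint slack by blast

lemma energy_eq:
  "energy edges B pv pq P Q x = - (\<Sum>i\<in>pv \<union> pq. P i * snd x $ i) - (\<Sum>i\<in>pq. Q i * fst x $ i)
     + (\<Sum>(i, j)\<in>edges. B i j * edge_energy x i j)"
  by (simp add: energy_def split_def edge_energy_def right_diff_distrib sum_subtractf mult.assoc)

lemma energy_deriv:
  "((\<lambda>t. energy edges B pv pq P Q (x + t *\<^sub>R h)) has_real_derivative energy_grad P Q (x + t *\<^sub>R h) h)
     (at t)"
proof -
  have "((\<lambda>t. \<Sum>e\<in>edges. B (fst e) (snd e) * edge_energy (x + t *\<^sub>R h) (fst e) (snd e)) has_real_derivative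
     (\<Sum>e\<in>edges. B (fst e) (snd e) * edge_grad (x + t *\<^sub>R h) h (fst e) (snd e))) (at t)"
    by (intro DERIV_sum DERIV_cmult edge_energy_deriv)
  moreover have "((\<lambda>t. - (\<Sum>i\<in>pv \<union> pq. P i * snd (x + t *\<^sub>R h) $ i)) has_real_derivative
     - (\<Sum>i\<in>pv \<union> pq. P i * snd h $ i)) (at t)"
    by (intro DERIV_minus DERIV_sum DERIV_cmult) (auto intro!: derivative_eq_intros)
  moreover have "((\<lambda>t. \<Sum>i\<in>pq. Q i * fst (x + t *\<^sub>R h) $ i) has_real_derivative
     (\<Sum>i\<in>pq. Q i * fst h $ i)) (at t)"
    by (intro DERIV_sum DERIV_cmult) (auto intro!: derivative_eq_intros)
  ultimately show ?thesis
    unfolding energy_eq energy_grad_def split_def by (intro DERIV_add DERIV_diff)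
qed

lemma energy_grad_deriv:
  "((\<lambda>t. energy_grad P Q (x + t *\<^sub>R k) h) has_real_derivative hess_form (x + t *\<^sub>R k) h k) (at t)"
proof -
  have "((\<lambda>t. \<Sum>e\<in>edges. B (fst e) (snd e) * edge_grad (x + t *\<^sub>R k) h (fst e) (snd e)) has_real_derivative
     (\<Sum>e\<in>edges. B (fst e) (snd e) * edge_hess (x + t *\<^sub>R k) h k (fst e) (snd e))) (at t)"
    by (intro DERIV_sum DERIV_cmult edge_grad_deriv)
  from DERIV_add[OF DERIV_const this] show ?thesis
    unfolding energy_grad_def hess_form_def split_def by simp
qed

text \<open>
  The second derivative along all of \<open>(\<rho>, \<theta>)\<close> is a symmetric bilinear form, so the matrix of
  second partial derivatives is its matrix in the coordinate directions.
\<close>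

lemma hessian_energy:
  "hessian (energy edges B pv pq P Q) x k l = hess_form x (coord_dir l) (coord_dir k)"
proof -
  have "partial_deriv (energy edges B pv pq P Q) l = (\<lambda>x. energy_grad P Q x (coord_dir l))"
    unfolding partial_deriv_def
    using energy_deriv[of P Q _ "coord_dir l" 0, THEN DERIV_imp_deriv] by simp
  then show ?thesis
    unfolding hessian_def
    using energy_grad_deriv[of P Q x "coord_dir k" "coord_dir l" 0, THEN DERIV_imp_deriv]
    by (simp add: partial_deriv_def)
qed

lemma hess_form_sym: "hess_form x h k = hess_form x k h"
  unfolding hess_form_def by (simp add: edge_hess_sym[of x h k])

lemma linear_hess_form: "linear (\<lambda>h. hess_form x h k)"
  by (rule linearI)
    (simp_all add: hess_form_def edge_hess_add edge_hess_scale split_def distrib_left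
       sum.distrib sum_distrib_left mult.left_commute)

lemma hess_form_sum:
  "(\<Sum>k\<in>T. \<Sum>l\<in>T. v k * hess_form x (d l) (d k) * v l)
     = hess_form x (\<Sum>k\<in>T. v k *\<^sub>R d k) (\<Sum>k\<in>T. v k *\<^sub>R d k)"
proof -
  let ?h = "\<Sum>k\<in>T. v k *\<^sub>R d k"
  have lin: "hess_form x ?h k = (\<Sum>l\<in>T. v l * hess_form x (d l) k)" for k
    by (simp add: linear_sum[OF linear_hess_form] linear_cmul[OF linear_hess_form])
  have "hess_form x ?h ?h = (\<Sum>k\<in>T. v k * hess_form x ?h (d k))"
    unfolding lin[of ?h] by (simp add: hess_form_sym[of x _ ?h])
  also have "\<dots> = (\<Sum>k\<in>T. \<Sum>l\<in>T. v k * hess_form x (d l) (d k) * v l)"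
    unfolding lin by (simp add: sum_distrib_left mult_ac)
  finally show ?thesis by simp
qed

lemma sum_coord_dir:
  "fst (\<Sum>k\<in>free_vars pv pq. v k *\<^sub>R coord_dir k) $ i = (if i \<in> pq then v (Inl i) else 0)"
  "snd (\<Sum>k\<in>free_vars pv pq. v k *\<^sub>R coord_dir k) $ i = (if i \<noteq> s then v (Inr i) else 0)"
proof -
  have F: "free_vars pv pq = pq <+> (pv \<union> pq)"
    by (auto simp: free_vars_def Plus_def)
  have ax: "c * (axis k 1 $ i :: real) = (if k = i then c else 0)" for c k
    by (simp add: axis_def)
  show "fst (\<Sum>k\<in>free_vars pv pq. v k *\<^sub>R coord_dir k) $ i = (if i \<in> pq then v (Inl i) else 0)"
    unfolding F by (simp add: fst_sum sum.Plus o_def ax)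
  have "i \<in> pv \<union> pq \<longleftrightarrow> i \<noteq> s" using nodes slack by blast
  then show "snd (\<Sum>k\<in>free_vars pv pq. v k *\<^sub>R coord_dir k) $ i = (if i \<noteq> s then v (Inr i) else 0)"
    unfolding F by (simp add: snd_sum sum.Plus o_def ax)
qed

lemma psd_hessian_iff:
  "psd_on (free_vars pv pq) (hessian (energy edges B pv pq P Q) x)
     \<longleftrightarrow> (\<forall>h\<in>states pq s. 0 \<le> hess_form x h h)"
proof -
  define dir where "dir v = (\<Sum>k\<in>free_vars pv pq. v k *\<^sub>R coord_dir k)" for v
  have dir: "dir v \<in> states pq s" for v
    by (simp add: dir_def mem_states sum_coord_dir)
  have surj: "\<exists>v. h = dir v" if "h \<in> states pq s" for h
  proof
    show "h = dir (case_sum (\<lambda>i. fst h $ i) (\<lambda>i. snd h $ i))"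
      using that unfolding dir_def by (auto simp: prod_eq_iff vec_eq_iff sum_coord_dir mem_states)
  qed
  have "psd_on (free_vars pv pq) (hessian (energy edges B pv pq P Q) x)
      \<longleftrightarrow> (\<forall>v. 0 \<le> hess_form x (dir v) (dir v))"
    unfolding psd_on_def hessian_energy hess_form_sum dir_def
    by (simp add: hess_form_sym)
  then show ?thesis using dir surj by metis
qed

text \<open>Each undirected edge is counted once by its orientation and appears as two ordered pairs.\<close>

lemma sum_over_edges:
  fixes f :: "'v \<Rightarrow> 'v \<Rightarrow> real"
  assumes "\<And>i j. \<not> adj edges i j \<Longrightarrow> f i j = 0"
  shows "(\<Sum>i\<in>UNIV. \<Sum>j\<in>UNIV. f i j) = (\<Sum>(i, j)\<in>edges. f i j + f j i)"
proof -
  have "(\<Sum>i\<in>UNIV. \<Sum>j\<in>UNIV. f i j) = (\<Sum>(i, j)\<in>UNIV. f i j)"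
    by (simp add: sum.cartesian_product)
  also have "\<dots> = (\<Sum>(i, j)\<in>edges \<union> prod.swap ` edges. f i j)"
  proof (rule sum.mono_neutral_right)
    show "\<forall>e\<in>UNIV - (edges \<union> prod.swap ` edges). (case e of (i, j) \<Rightarrow> f i j) = 0"
    proof
      fix e assume "e \<in> UNIV - (edges \<union> prod.swap ` edges)"
      moreover have "(snd e, fst e) \<in> edges \<Longrightarrow> e \<in> prod.swap ` edges"
        by (rule image_eqI[of _ _ "(snd e, fst e)"]) simp_all
      ultimately have "\<not> adj edges (fst e) (snd e)" by (auto simp: adj_def)
      then show "(case e of (i, j) \<Rightarrow> f i j) = 0" by (simp add: assms split_def)
    qed
  qed auto
  also have "\<dots> = (\<Sum>(i, j)\<in>edges. f i j) + (\<Sum>(i, j)\<in>prod.swap ` edges. f i j)"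
    by (intro sum.union_disjoint) (auto dest: oriented)
  also have "(\<Sum>(i, j)\<in>prod.swap ` edges. f i j) = (\<Sum>(i, j)\<in>edges. f j i)"
    by (subst sum.reindex) (auto simp: o_def split_def)
  finally show ?thesis by (simp add: split_def sum.distrib)
qed

text \<open>
  The nodal sums \<open>2 B\<^sub>i\<close> and the terms for neighbours outside \<open>pq\<close> are regrouped by edges. Cutting
  \<open>v\<close> off outside \<open>pq\<close> lets one formula serve all three kinds of edges.
\<close>

lemma C_matrix_quadratic_form:
  "(\<Sum>k\<in>pq. \<Sum>l\<in>pq. v k * C_matrix edges B pv pq s x k l * v l)
     = voltage_form x (\<lambda>i. if i \<in> pq then v i else 0)"
proof -
  let ?a = "\<lambda>i. if i \<in> pq then v i else 0"
  let ?co = "\<lambda>i j. cos (snd x $ i - snd x $ j)"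
  let ?ex = "\<lambda>i j. exp (fst x $ i - fst x $ j)"
  define c where "c i = 2 * nodal_B edges B i - (\<Sum>j\<in>pv \<union> {s}. B i j * (?ex j i / ?co j i))" for i
  define N where "N = {(i, j) \<in> edges. i \<in> pq \<and> j \<in> pq}"
  define M where "M e k l = B (fst e) (snd e) / ?co (fst e) (snd e) *
     block_entry (fst e) (snd e) (?ex (snd e) (fst e)) 1 1 (?ex (fst e) (snd e)) k l" for e k l
  have C: "C_matrix edges B pv pq s x k l = (\<Sum>i\<in>pq. diag_entry i (c i) k l) - (\<Sum>e\<in>N. M e k l)" for k l
    by (simp add: C_matrix_def c_def N_def M_def split_def)
  have diag: "(\<Sum>k\<in>pq. \<Sum>l\<in>pq. v k * (\<Sum>i\<in>pq. diag_entry i (c i) k l) * v l) = (\<Sum>k\<in>pq. c k * (v k)\<^sup>2)"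
  proof (rule sum.cong[OF refl])
    fix k assume k: "k \<in> pq"
    have "(\<Sum>i\<in>pq. diag_entry i (c i) k l) = (if l = k then c k else 0)" for l
    proof -
      have "diag_entry i (c i) k l = (if i = k then (if l = k then c k else 0) else 0)" for i
        by (auto simp: diag_entry_def)
      then show ?thesis using k by simp
    qed
    then show "(\<Sum>l\<in>pq. v k * (\<Sum>i\<in>pq. diag_entry i (c i) k l) * v l) = c k * (v k)\<^sup>2"
      using k by (simp add: if_distrib[of "\<lambda>z. _ * z"] if_distrib[of "\<lambda>z. z * _"] power2_eq_square mult_ac cong: if_cong)
  qed
  have block: "(\<Sum>k\<in>pq. \<Sum>l\<in>pq. v k * (\<Sum>e\<in>N. M e k l) * v l)
     = (\<Sum>(i, j)\<in>N. B i j / ?co i j * ((v i)\<^sup>2 * ?ex j i + 2 * v i * v j + (v j)\<^sup>2 * ?ex i j))"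
  proof -
    have "(\<Sum>k\<in>pq. \<Sum>l\<in>pq. v k * (\<Sum>e\<in>N. M e k l) * v l)
       = (\<Sum>k\<in>pq. \<Sum>l\<in>pq. \<Sum>e\<in>N. v k * M e k l * v l)"
      by (simp add: sum_distrib_left sum_distrib_right)
    also have "\<dots> = (\<Sum>k\<in>pq. \<Sum>e\<in>N. \<Sum>l\<in>pq. v k * M e k l * v l)"
      by (intro sum.cong refl sum.swap)
    also have "\<dots> = (\<Sum>e\<in>N. \<Sum>k\<in>pq. \<Sum>l\<in>pq. v k * M e k l * v l)"
      by (rule sum.swap)
    also have "\<dots> = (\<Sum>(i, j)\<in>N. B i j / ?co i j * ((v i)\<^sup>2 * ?ex j i + 2 * v i * v j + (v j)\<^sup>2 * ?ex i j))"
    proof (rule sum.cong[OF refl], clarify)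
      fix i j assume "(i, j) \<in> N"
      then have ij: "i \<in> pq" "j \<in> pq" "i \<noteq> j" using edge_neq by (auto simp: N_def)
      have "(\<Sum>k\<in>pq. \<Sum>l\<in>pq. v k * M (i, j) k l * v l)
        = B i j / ?co i j * (\<Sum>k\<in>pq. \<Sum>l\<in>pq. v k * block_entry i j (?ex j i) 1 1 (?ex i j) k l * v l)"
        by (simp add: M_def sum_distrib_left mult_ac)
      then show "(\<Sum>k\<in>pq. \<Sum>l\<in>pq. v k * M (i, j) k l * v l)
        = B i j / ?co i j * ((v i)\<^sup>2 * ?ex j i + 2 * v i * v j + (v j)\<^sup>2 * ?ex i j)"
        using block_quadratic_form[of pq i j v "?ex j i" 1 1 "?ex i j"] ij by simp
    qed
    finally show ?thesis .
  qed
  have "(\<Sum>k\<in>pq. c k * (v k)\<^sup>2) = (\<Sum>i\<in>UNIV. \<Sum>j\<in>UNIV.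
      (?a i)\<^sup>2 * (B i j * (2 - (if j \<in> pq then 0 else ?ex j i / ?co j i))))" (is "_ = (\<Sum>i\<in>_. \<Sum>j\<in>_. ?f i j)")
  proof -
    have "c i = (\<Sum>j\<in>UNIV. B i j * (2 - (if j \<in> pq then 0 else ?ex j i / ?co j i)))" for i
    proof -
      have "nodal_B edges B i = (\<Sum>j\<in>UNIV. B i j)"
        unfolding nodal_B_def using B_zero by (intro sum.mono_neutral_left) (auto simp: adj_def)
      moreover have "(\<Sum>j\<in>pv \<union> {s}. B i j * (?ex j i / ?co j i))
         = (\<Sum>j\<in>UNIV. B i j * (if j \<in> pq then 0 else ?ex j i / ?co j i))"
        by (rule sum.mono_neutral_cong_left) (auto simp: not_pq_iff slack dest: pv_pq_disjoint[THEN equalityD1, THEN subsetD, OF IntI])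
      ultimately show ?thesis unfolding c_def
        by (simp add: right_diff_distrib sum_subtractf sum_distrib_left mult.commute)
    qed
    then have "c i * (?a i)\<^sup>2 = (\<Sum>j\<in>UNIV. ?f i j)" for i
      by (simp add: sum_distrib_left mult_ac)
    moreover have "(\<Sum>k\<in>pq. c k * (v k)\<^sup>2) = (\<Sum>k\<in>UNIV. c k * (?a k)\<^sup>2)"
      by (rule sum.mono_neutral_cong_left) auto
    ultimately show ?thesis by simp
  qed
  also have "\<dots> = (\<Sum>(i, j)\<in>edges. ?f i j + ?f j i)"
    by (rule sum_over_edges) (simp add: B_zero)
  finally have cs: "(\<Sum>k\<in>pq. c k * (v k)\<^sup>2) = (\<Sum>(i, j)\<in>edges. ?f i j + ?f j i)" .
  have ns: "(\<Sum>(i, j)\<in>N. B i j / ?co i j * ((v i)\<^sup>2 * ?ex j i + 2 * v i * v j + (v j)\<^sup>2 * ?ex i j))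
     = (\<Sum>(i, j)\<in>edges. if i \<in> pq \<and> j \<in> pq then
          B i j / ?co i j * ((v i)\<^sup>2 * ?ex j i + 2 * v i * v j + (v j)\<^sup>2 * ?ex i j) else 0)"
    by (rule sum.mono_neutral_cong_left) (auto simp: N_def split: if_splits)
  have co: "?co j i = ?co i j" for i j
    using cos_minus[of "snd x $ i - snd x $ j"] by simp
  have "(\<Sum>k\<in>pq. \<Sum>l\<in>pq. v k * C_matrix edges B pv pq s x k l * v l)
     = (\<Sum>(i, j)\<in>edges. ?f i j + ?f j i - (if i \<in> pq \<and> j \<in> pq then
          B i j / ?co i j * ((v i)\<^sup>2 * ?ex j i + 2 * v i * v j + (v j)\<^sup>2 * ?ex i j) else 0))"
    unfolding C right_diff_distrib left_diff_distrib sum_subtractf diag block cs ns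
    by (simp only: split_def sum_subtractf)
  also have "\<dots> = voltage_form x ?a"
    unfolding voltage_form_def
  proof (intro sum.cong refl, clarify)
    fix i j assume "(i, j) \<in> edges"
    show "?f i j + ?f j i - (if i \<in> pq \<and> j \<in> pq then
          B i j / ?co i j * ((v i)\<^sup>2 * ?ex j i + 2 * v i * v j + (v j)\<^sup>2 * ?ex i j) else 0)
        = B i j * edge_voltage x ?a i j"
      unfolding co[of j i] B_sym[of j i] edge_voltage_def
      by (cases "i \<in> pq"; cases "j \<in> pq") (simp_all add: algebra_simps add_divide_distrib)
  qed
  finally show ?thesis .
qed

lemma C_matrix_sym: "C_matrix edges B pv pq s x k l = C_matrix edges B pv pq s x l k"
proof -
  have diag: "diag_entry i a k l = diag_entry i a l k" for i :: 'v and a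
    unfolding diag_entry_def by (cases "k = i"; cases "l = i") auto
  have block: "block_entry i j a 1 1 d k l = block_entry i j a 1 1 d l k" if "(i, j) \<in> edges" for i j a d
    using edge_neq[OF that] unfolding block_entry_def by (cases "k = i"; cases "l = i") auto
  show ?thesis
    unfolding C_matrix_def split_def
    by (rule arg_cong2[where f = "(-)"]; rule sum.cong[OF refl]) (auto intro!: diag block arg_cong2[where f = "(*)"])
qed

lemma psd_C_matrix_iff:
  "psd_on pq (C_matrix edges B pv pq s x) \<longleftrightarrow> (\<forall>v. (\<forall>i. i \<notin> pq \<longrightarrow> v i = 0) \<longrightarrow> 0 \<le> voltage_form x v)"
proof -
  have "psd_on pq (C_matrix edges B pv pq s x)
      \<longleftrightarrow> (\<forall>v. 0 \<le> voltage_form x (\<lambda>i. if i \<in> pq then v i else 0))"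
    unfolding psd_on_def C_matrix_quadratic_form using C_matrix_sym by blast
  also have "\<dots> \<longleftrightarrow> (\<forall>v. (\<forall>i. i \<notin> pq \<longrightarrow> v i = 0) \<longrightarrow> 0 \<le> voltage_form x v)"
  proof (intro iffI allI impI)
    fix v :: "'v \<Rightarrow> real"
    assume all: "\<forall>v. 0 \<le> voltage_form x (\<lambda>i. if i \<in> pq then v i else 0)" and v: "\<forall>i. i \<notin> pq \<longrightarrow> v i = 0"
    have "(\<lambda>i. if i \<in> pq then v i else 0) = v" using v by auto
    with all[rule_format, of v] show "0 \<le> voltage_form x v" by simp
  qed simp
  finally show ?thesis .
qed

section \<open>Convexity of the set and of the energy\<close>

lemma mem_set_C:
  "x \<in> set_C edges B pv pq s \<longleftrightarrow> x \<in> states pq s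
    \<and> (\<forall>i j. (i, j) \<in> edges \<longrightarrow> \<bar>snd x $ i - snd x $ j\<bar> \<le> pi / 2)
    \<and> (\<forall>i j. (i, j) \<in> edges \<longrightarrow> i \<in> pq \<or> j \<in> pq \<longrightarrow> cos (snd x $ i - snd x $ j) \<noteq> 0)
    \<and> (\<forall>v. (\<forall>i. i \<notin> pq \<longrightarrow> v i = 0) \<longrightarrow> 0 \<le> voltage_form x v)"
  by (cases x) (auto simp add: set_C_def psd_C_matrix_iff)

lemma set_C_phase_le: "x \<in> set_C edges B pv pq s \<Longrightarrow> (i, j) \<in> edges \<Longrightarrow> \<bar>snd x $ i - snd x $ j\<bar> \<le> pi / 2"
  unfolding mem_set_C by blast

lemma set_C_cos_nonneg:
  assumes "x \<in> set_C edges B pv pq s" "(i, j) \<in> edges"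
  shows "0 \<le> cos (snd x $ i - snd x $ j)"
  using set_C_phase_le[OF assms] by (intro cos_ge_zero) linarith+

lemma set_C_cos_pos:
  assumes "x \<in> set_C edges B pv pq s" "(i, j) \<in> edges" "i \<in> pq \<or> j \<in> pq"
  shows "0 < cos (snd x $ i - snd x $ j)"
proof -
  have "cos (snd x $ i - snd x $ j) \<noteq> 0" using assms unfolding mem_set_C by blast
  with set_C_cos_nonneg[OF assms(1,2)] show ?thesis by linarith
qed

lemma set_C_phase_less:
  assumes "x \<in> set_C edges B pv pq s" "(i, j) \<in> edges" "i \<in> pq \<or> j \<in> pq"
  shows "\<bar>snd x $ i - snd x $ j\<bar> < pi / 2"
  using set_C_phase_le[OF assms(1,2)] set_C_cos_pos[OF assms] by (intro abs_less_of_cos) auto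

lemma set_C_voltage_form_nonneg:
  assumes "x \<in> set_C edges B pv pq s" "\<forall>i. i \<notin> pq \<longrightarrow> v i = 0"
  shows "0 \<le> voltage_form x v"
  using assms unfolding mem_set_C by simp

text \<open>
  The coefficient of \<open>v\<^sub>i v\<^sub>j\<close> is \<open>- 2 B\<^sub>i\<^sub>j / cos \<theta>\<^sub>i\<^sub>j \<le> 0\<close>. Consequently nonnegativity of the
  form needs to be checked only for \<open>v \<ge> 0\<close>.
\<close>

lemma voltage_form_abs_le:
  assumes cos: "\<And>i j. (i, j) \<in> edges \<Longrightarrow> i \<in> pq \<or> j \<in> pq \<Longrightarrow> 0 < cos (snd x $ i - snd x $ j)"
    and v: "\<forall>i. i \<notin> pq \<longrightarrow> v i = 0"
  shows "voltage_form x (\<lambda>i. \<bar>v i\<bar>) \<le> voltage_form x v"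
  unfolding voltage_form_def
proof (rule sum_mono, clarify)
  fix i j assume e: "(i, j) \<in> edges"
  have "edge_voltage x (\<lambda>i. \<bar>v i\<bar>) i j \<le> edge_voltage x v i j"
  proof (cases "i \<in> pq \<or> j \<in> pq")
    case True
    have "v i * v j \<le> \<bar>v i\<bar> * \<bar>v j\<bar>" by (metis abs_ge_self abs_mult)
    with cos[OF e True] show ?thesis
      unfolding edge_voltage_def by (simp add: divide_right_mono)
  next
    case False
    with v show ?thesis by (simp add: edge_voltage_def)
  qed
  then show "B i j * edge_voltage x (\<lambda>i. \<bar>v i\<bar>) i j \<le> B i j * edge_voltage x v i j"
    using edge_B_pos[OF e] by simp
qed

lemma voltage_form_concave:
  assumes x: "x \<in> set_C edges B pv pq s" and y: "y \<in> set_C edges B pv pq s"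
    and v: "\<forall>i. i \<notin> pq \<longrightarrow> v i = 0" "\<And>i. 0 \<le> v i" and ab: "0 \<le> a" "0 \<le> b" "a + b = 1"
  shows "a * voltage_form x v + b * voltage_form y v \<le> voltage_form (a *\<^sub>R x + b *\<^sub>R y) v"
proof -
  have "a * voltage_form x v + b * voltage_form y v
    = (\<Sum>(i, j)\<in>edges. B i j * (a * edge_voltage x v i j + b * edge_voltage y v i j))"
    by (simp add: voltage_form_def sum_distrib_left split_def sum.distrib algebra_simps)
  also have "\<dots> \<le> voltage_form (a *\<^sub>R x + b *\<^sub>R y) v"
    unfolding voltage_form_def
  proof (rule sum_mono, clarify)
    fix i j assume e: "(i, j) \<in> edges"
    have "a * edge_voltage x v i j + b * edge_voltage y v i j \<le> edge_voltage (a *\<^sub>R x + b *\<^sub>R y) v i j"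
    proof (cases "i \<in> pq \<or> j \<in> pq")
      case True
      show ?thesis
        using set_C_phase_less[OF x e True] set_C_phase_less[OF y e True] v(2) ab
        by (intro edge_voltage_concave)
    next
      case False
      with v(1) show ?thesis by (simp add: edge_voltage_def)
    qed
    then show "B i j * (a * edge_voltage x v i j + b * edge_voltage y v i j)
        \<le> B i j * edge_voltage (a *\<^sub>R x + b *\<^sub>R y) v i j"
      using edge_B_pos[OF e] by simp
  qed
  finally show ?thesis .
qed

lemma convex_set_C: "convex (set_C edges B pv pq s)"
proof (rule convexI)
  fix x y and a b :: real
  assume x: "x \<in> set_C edges B pv pq s" and y: "y \<in> set_C edges B pv pq s"
    and ab: "0 \<le> a" "0 \<le> b" "a + b = 1"
  let ?z = "a *\<^sub>R x + b *\<^sub>R y"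
  have combine: "\<bar>snd ?z $ i - snd ?z $ j\<bar> \<le> a * \<bar>snd x $ i - snd x $ j\<bar> + b * \<bar>snd y $ i - snd y $ j\<bar>" for i j
  proof -
    have "snd ?z $ i - snd ?z $ j = a * (snd x $ i - snd x $ j) + b * (snd y $ i - snd y $ j)"
      by (simp add: algebra_simps)
    then show ?thesis
      using ab abs_triangle_ineq[of "a * (snd x $ i - snd x $ j)" "b * (snd y $ i - snd y $ j)"]
      by (simp add: abs_mult)
  qed
  have "?z \<in> states pq s"
    using x y subspace_states[of pq s] unfolding mem_set_C by (simp add: subspace_add subspace_scale)
  moreover have "\<bar>snd ?z $ i - snd ?z $ j\<bar> \<le> pi / 2" if e: "(i, j) \<in> edges" for i j
    using combine[of i j] convex_bound_le[OF set_C_phase_le[OF x e] set_C_phase_le[OF y e] ab] by linarith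
  moreover have cos: "0 < cos (snd ?z $ i - snd ?z $ j)" if e: "(i, j) \<in> edges" and t: "i \<in> pq \<or> j \<in> pq" for i j
  proof -
    have "\<bar>snd ?z $ i - snd ?z $ j\<bar> < pi / 2"
      using combine[of i j] convex_bound_lt[OF set_C_phase_less[OF x e t] set_C_phase_less[OF y e t] ab] by linarith
    then show ?thesis by (intro cos_gt_zero_pi) (simp_all only: abs_less_iff, simp_all)
  qed
  moreover have "0 \<le> voltage_form ?z v" if v: "\<forall>i. i \<notin> pq \<longrightarrow> v i = 0" for v
  proof -
    let ?v = "\<lambda>i. \<bar>v i\<bar>"
    have v': "\<forall>i. i \<notin> pq \<longrightarrow> ?v i = 0" using v by simp
    have "0 \<le> a * voltage_form x ?v + b * voltage_form y ?v"
      using ab set_C_voltage_form_nonneg[OF x v'] set_C_voltage_form_nonneg[OF y v'] by simp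
    also have "\<dots> \<le> voltage_form ?z ?v" using v' ab by (intro voltage_form_concave[OF x y]) auto
    also have "\<dots> \<le> voltage_form ?z v" using cos v by (intro voltage_form_abs_le)
    finally show ?thesis .
  qed
  moreover have "cos (snd ?z $ i - snd ?z $ j) \<noteq> 0" if "(i, j) \<in> edges" "i \<in> pq \<or> j \<in> pq" for i j
    using cos[OF that] by simp
  ultimately show "?z \<in> set_C edges B pv pq s" unfolding mem_set_C by blast
qed

text \<open>At the origin the form is the Laplacian form \<open>\<Sum> B\<^sub>i\<^sub>j (v\<^sub>i - v\<^sub>j)\<^sup>2\<close>.\<close>

lemma zero_in_set_C: "0 \<in> set_C edges B pv pq s"
proof -
  have "0 \<le> voltage_form 0 v" for v
    unfolding voltage_form_def
  proof (rule sum_nonneg, clarify)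
    fix i j assume e: "(i, j) \<in> edges"
    have "edge_voltage 0 v i j = (v i - v j)\<^sup>2"
      by (simp add: edge_voltage_def power2_eq_square algebra_simps)
    then show "0 \<le> B i j * edge_voltage 0 v i j"
      using edge_B_pos[OF e] by simp
  qed
  then show ?thesis unfolding mem_set_C by (simp add: mem_states)
qed

lemma scale_in_set_C:
  assumes "x \<in> set_C edges B pv pq s" "0 \<le> c" "c \<le> 1"
  shows "c *\<^sub>R x \<in> set_C edges B pv pq s"
  using convexD[OF convex_set_C assms(1) zero_in_set_C, of c "1 - c"] assms(2,3) by simp

text \<open>For an edge without endpoint in \<open>pq\<close> the identity survives \<open>cos \<theta>\<^sub>i\<^sub>j = 0\<close>, since \<open>u\<^sub>i = u\<^sub>j = 0\<close>.\<close>

lemma hess_form_eq: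
  assumes cos: "\<And>i j. (i, j) \<in> edges \<Longrightarrow> i \<in> pq \<or> j \<in> pq \<Longrightarrow> cos (snd x $ i - snd x $ j) \<noteq> 0"
    and h: "h \<in> states pq s"
  shows "hess_form x h h = voltage_form x (\<lambda>i. exp (fst x $ i) * fst h $ i)
    + phase_form x h"
proof -
  let ?q = "\<lambda>i j. exp (fst x $ i + fst x $ j) * cos (snd x $ i - snd x $ j) *
      (snd h $ i - snd h $ j + (fst h $ i + fst h $ j) * tan (snd x $ i - snd x $ j))\<^sup>2"
  have "hess_form x h h = (\<Sum>(i, j)\<in>edges. B i j *
      (edge_voltage x (\<lambda>i. exp (fst x $ i) * fst h $ i) i j + ?q i j))"
    unfolding hess_form_def
  proof (intro sum.cong refl, clarify)
    fix i j assume e: "(i, j) \<in> edges"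
    have "edge_hess x h h i j = edge_voltage x (\<lambda>i. exp (fst x $ i) * fst h $ i) i j + ?q i j"
    proof (cases "i \<in> pq \<or> j \<in> pq")
      case True
      show ?thesis using cos[OF e True] by (rule edge_hess_complete_square)
    next
      case False
      with h have "fst h $ i = 0" "fst h $ j = 0" by (auto simp: mem_states)
      then show ?thesis by (simp add: edge_hess_def edge_voltage_def power2_eq_square)
    qed
    then show "B i j * edge_hess x h h i j
        = B i j * (edge_voltage x (\<lambda>i. exp (fst x $ i) * fst h $ i) i j + ?q i j)" by simp
  qed
  then show ?thesis
    by (simp only: voltage_form_def phase_form_def distrib_left split_def sum.distrib)
qed

lemma hess_form_eq_on_set_C:
  assumes x: "x \<in> set_C edges B pv pq s" and h: "h \<in> states pq s"
  shows "hess_form x h h = voltage_form x (\<lambda>i. exp (fst x $ i) * fst h $ i)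
    + phase_form x h"
proof (rule hess_form_eq[OF _ h])
  show "cos (snd x $ i - snd x $ j) \<noteq> 0" if "(i, j) \<in> edges" "i \<in> pq \<or> j \<in> pq" for i j
    using set_C_cos_pos[OF x that] by simp
qed

lemma phase_form_nonneg:
  assumes x: "x \<in> set_C edges B pv pq s"
  shows "0 \<le> phase_form x h"
  unfolding phase_form_def
proof (rule sum_nonneg, clarify)
  fix i j assume e: "(i, j) \<in> edges"
  show "0 \<le> B i j * (exp (fst x $ i + fst x $ j) * cos (snd x $ i - snd x $ j) *
    (snd h $ i - snd h $ j + (fst h $ i + fst h $ j) * tan (snd x $ i - snd x $ j))\<^sup>2)"
    using edge_B_pos[OF e] set_C_cos_nonneg[OF x e] by simp
qed

lemma hess_form_nonneg:
  assumes x: "x \<in> set_C edges B pv pq s" and h: "h \<in> states pq s"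
  shows "0 \<le> hess_form x h h"
proof -
  have "0 \<le> voltage_form x (\<lambda>i. exp (fst x $ i) * fst h $ i)"
  proof -
    have "\<forall>i. i \<notin> pq \<longrightarrow> exp (fst x $ i) * fst h $ i = 0" using h by (simp add: mem_states)
    with x show ?thesis by (rule set_C_voltage_form_nonneg)
  qed
  moreover have "0 \<le> phase_form x h" using x by (rule phase_form_nonneg)
  ultimately show ?thesis unfolding hess_form_eq_on_set_C[OF x h] by simp
qed

lemma set_C_subset_domain_D: "set_C edges B pv pq s \<subseteq> domain_D edges B pv pq s P Q"
proof
  fix x assume x: "x \<in> set_C edges B pv pq s"
  then have "x \<in> states pq s" unfolding mem_set_C by blast
  with x show "x \<in> domain_D edges B pv pq s P Q"
    unfolding domain_D_def psd_hessian_iff by (auto intro!: hess_form_nonneg scale_in_set_C)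
qed

lemma convex_energy: "convex_on (set_C edges B pv pq s) (energy edges B pv pq P Q)"
proof (rule convex_onI)
  fix t :: real and x y
  assume t: "0 < t" "t < 1" and x: "x \<in> set_C edges B pv pq s" and y: "y \<in> set_C edges B pv pq s"
  let ?h = "y - x"
  let ?f = "\<lambda>t. energy edges B pv pq P Q (x + t *\<^sub>R ?h)"
  have h: "?h \<in> states pq s"
    using x y subspace_states[of pq s] unfolding mem_set_C by (simp add: subspace_diff)
  have "convex_on {0..1} ?f"
  proof (rule f''_ge0_imp_convex)
    fix t :: real assume "t \<in> {0..1}"
    then have "x + t *\<^sub>R ?h \<in> set_C edges B pv pq s"
      using convexD[OF convex_set_C x y, of "1 - t" t] unfolding segment_eq by simp
    then show "0 \<le> hess_form (x + t *\<^sub>R ?h) ?h ?h" using h by (rule hess_form_nonneg)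
  qed (simp, rule energy_deriv, rule energy_grad_deriv)
  from convex_onD[OF this, of t 0 1] t
  show "energy edges B pv pq P Q ((1 - t) *\<^sub>R x + t *\<^sub>R y)
      \<le> (1 - t) * energy edges B pv pq P Q x + t * energy edges B pv pq P Q y"
    unfolding segment_eq by simp
qed (rule convex_set_C)

section \<open>The domain of convexity of a tree\<close>

lemma tree_potential:
  fixes d :: "'v \<Rightarrow> 'v \<Rightarrow> real"
  assumes "is_tree edges"
  obtains w :: "real ^ 'v" where "w $ s = 0" "\<And>i j. (i, j) \<in> edges \<Longrightarrow> w $ i - w $ j = d i j"
proof -
  obtain w where w: "\<forall>(i, j)\<in>edges. w i - w j = d i j"
    using forest_potential[of edges d] oriented assms unfolding is_tree_def by auto
  show thesis
    by (rule that[of "\<chi> i. w i - w s"]) (use w in auto)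
qed

lemma domain_D_hess_nonneg:
  assumes "x \<in> domain_D edges B pv pq s P Q" "h \<in> states pq s" "0 \<le> c" "c \<le> 1"
  shows "0 \<le> hess_form (c *\<^sub>R x) h h"
  using assms unfolding domain_D_def psd_hessian_iff by auto

text \<open>
  On a tree some phase direction annihilates all completed squares at once. What is left of the
  Hessian form is the form of the matrix, which inherits its nonnegativity.
\<close>

lemma domain_D_subset_set_C:
  assumes tree: "is_tree edges"
  shows "domain_D edges B pv pq s P Q \<subseteq> set_C edges B pv pq s"
proof
  fix x assume x: "x \<in> domain_D edges B pv pq s P Q"
  have D1: "0 \<le> hess_form x h h" if "h \<in> states pq s" for h
    using domain_D_hess_nonneg[OF x that, of 1] by simp
  \<comment> \<open>Phase directions whose difference is 1 on one edge and 0 on all others isolate that edge.\<close>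
  have single: "\<exists>w. w $ s = 0 \<and> (\<forall>y u. hess_form y (u, 0) (0, w) = B i j * (exp (fst y $ i + fst y $ j) *
          ((u $ i + u $ j) * sin (snd y $ i - snd y $ j))))
      \<and> (\<forall>y. hess_form y (0, w) (0, w) = B i j * (exp (fst y $ i + fst y $ j) * cos (snd y $ i - snd y $ j)))"
    if e: "(i, j) \<in> edges" for i j
  proof -
    obtain w :: "real ^ 'v" where w: "w $ s = 0"
      "\<And>k l. (k, l) \<in> edges \<Longrightarrow> w $ k - w $ l = (if (k, l) = (i, j) then 1 else 0)"
      using tree_potential[OF tree, of "\<lambda>k l. if (k, l) = (i, j) then 1 else 0"] by blast
    have "hess_form y (u, 0) (0, w) = (\<Sum>e\<in>edges. if e = (i, j) then B i j * (exp (fst y $ i + fst y $ j) *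
          ((u $ i + u $ j) * sin (snd y $ i - snd y $ j))) else 0)" for y u
      unfolding hess_form_def by (intro sum.cong refl) (auto simp: edge_hess_def w(2) split: if_splits)
    moreover have "hess_form y (0, w) (0, w) = (\<Sum>e\<in>edges. if e = (i, j) then
        B i j * (exp (fst y $ i + fst y $ j) * cos (snd y $ i - snd y $ j)) else 0)" for y
      unfolding hess_form_def by (intro sum.cong refl) (auto simp: edge_hess_def w(2) split: if_splits)
    ultimately show ?thesis using w(1) e by (intro exI[of _ w]) simp
  qed
  have phase: "\<bar>snd x $ i - snd x $ j\<bar> \<le> pi / 2" if e: "(i, j) \<in> edges" for i j
  proof (rule ccontr)
    let ?t = "snd x $ i - snd x $ j"
    assume *: "\<not> \<bar>?t\<bar> \<le> pi / 2"
    \<comment> \<open>Scaling by \<open>c\<close> brings the phase difference to \<open>min \<bar>t\<bar> pi\<close>, where the cosine is negative.\<close>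
    define c where "c = min \<bar>?t\<bar> pi / \<bar>?t\<bar>"
    have t: "\<bar>?t\<bar> > 0" using * pi_gt_zero by linarith
    then have c: "0 \<le> c" "c \<le> 1" by (simp_all add: c_def)
    have "\<bar>c * ?t\<bar> = min \<bar>?t\<bar> pi" using t by (simp add: c_def abs_mult)
    moreover have "cos (min \<bar>?t\<bar> pi) < 0"
      using * cos_monotone_0_pi[of "pi / 2" "min \<bar>?t\<bar> pi"] pi_gt_zero by simp
    ultimately have neg: "cos (c * ?t) < 0" by (metis cos_abs_real)
    obtain w where w: "w $ s = 0" "\<And>y. hess_form y (0, w) (0, w) = B i j * (exp (fst y $ i + fst y $ j) * cos (snd y $ i - snd y $ j))"
      using single[OF e] by blast
    have "0 \<le> hess_form (c *\<^sub>R x) (0, w) (0, w)"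
      using w(1) c by (intro domain_D_hess_nonneg[OF x]) (simp_all add: mem_states)
    moreover have "snd (c *\<^sub>R x) $ i - snd (c *\<^sub>R x) $ j = c * ?t" by (simp add: algebra_simps)
    ultimately have "0 \<le> B i j * (exp (fst (c *\<^sub>R x) $ i + fst (c *\<^sub>R x) $ j) * cos (c * ?t))"
      unfolding w(2) by simp
    then show False using edge_B_pos[OF e] neg by (simp add: zero_le_mult_iff)
  qed
  have cos: "cos (snd x $ i - snd x $ j) \<noteq> 0" if e: "(i, j) \<in> edges" and t: "i \<in> pq \<or> j \<in> pq" for i j
  proof
    let ?t = "snd x $ i - snd x $ j"
    assume c: "cos ?t = 0"
    then have si: "sin ?t \<noteq> 0" using sin_cos_squared_add[of ?t] by auto
    obtain w where w: "w $ s = 0"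
      "\<And>y u. hess_form y (u, 0) (0, w) = B i j * (exp (fst y $ i + fst y $ j) *
          ((u $ i + u $ j) * sin (snd y $ i - snd y $ j)))"
      "\<And>y. hess_form y (0, w) (0, w) = B i j * (exp (fst y $ i + fst y $ j) * cos (snd y $ i - snd y $ j))"
      using single[OF e] by blast
    obtain u :: "real ^ 'v" where u: "\<forall>k. k \<notin> pq \<longrightarrow> u $ k = 0" "u $ i + u $ j = 1"
    proof -
      obtain k where "k \<in> pq" "k = i \<or> k = j" using t by blast
      then show ?thesis using edge_neq[OF e] by (intro that[of "axis k 1"]) (auto simp: axis_def)
    qed
    let ?a = "hess_form x (u, 0) (u, 0)" and ?b = "hess_form x (u, 0) (0, w)"
    have b: "?b \<noteq> 0" using w(2) u(2) si edge_B_pos[OF e] by simp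
    have expand: "hess_form x (u, r *\<^sub>R w) (u, r *\<^sub>R w) = ?a + 2 * r * ?b" for r
    proof -
      have pair: "(u, r *\<^sub>R w) = (u, 0) + r *\<^sub>R (0, w)" by simp
      have add: "hess_form x ((u, 0) + r *\<^sub>R (0, w)) k = hess_form x (u, 0) k + r * hess_form x (0, w) k" for k
        by (simp only: linear_add[OF linear_hess_form] linear_cmul[OF linear_hess_form] real_scaleR_def)
      have add': "hess_form x k ((u, 0) + r *\<^sub>R (0, w)) = hess_form x k (u, 0) + r * hess_form x k (0, w)" for k
        using add[of k] by (simp only: hess_form_sym[of x k])
      have "hess_form x (0, w) (u, 0) = ?b" by (rule hess_form_sym)
      moreover have "hess_form x (0, w) (0, w) = 0" using w(3) c by simp
      ultimately show ?thesis
        unfolding pair add add' by (simp add: algebra_simps)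
    qed
    \<comment> \<open>Without a quadratic term the form is affine in \<open>r\<close> with slope \<open>2 * ?b \<noteq> 0\<close>, so it takes the value \<open>- 1\<close>.\<close>
    have "0 \<le> ?a + 2 * (- (?a + 1) / (2 * ?b)) * ?b"
      unfolding expand[symmetric] using u(1) w(1) by (intro D1) (simp add: mem_states)
    also have "\<dots> = - 1" using b by (simp add: field_simps)
    finally show False by simp
  qed
  have "0 \<le> voltage_form x v" if v: "\<forall>i. i \<notin> pq \<longrightarrow> v i = 0" for v
  proof -
    define u :: "real ^ 'v" where "u = (\<chi> i. v i / exp (fst x $ i))"
    \<comment> \<open>The phases \<open>w\<close> minimise the Hessian form for the given \<open>u\<close>.\<close>
    obtain w :: "real ^ 'v" where w: "w $ s = 0"
      "\<And>i j. (i, j) \<in> edges \<Longrightarrow> w $ i - w $ j = - ((u $ i + u $ j) * tan (snd x $ i - snd x $ j))"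
      using tree_potential[OF tree, of "\<lambda>i j. - ((u $ i + u $ j) * tan (snd x $ i - snd x $ j))"] by blast
    have h: "(u, w) \<in> states pq s" using v w(1) by (simp add: mem_states u_def)
    have "0 \<le> hess_form x (u, w) (u, w)" using h by (rule D1)
    also have "hess_form x (u, w) (u, w) = voltage_form x (\<lambda>i. exp (fst x $ i) * u $ i) + phase_form x (u, w)"
      using hess_form_eq[OF cos h] by simp
    also have "phase_form x (u, w) = 0"
      unfolding phase_form_def by (intro sum.neutral) (auto simp: w(2))
    also have "(\<lambda>i. exp (fst x $ i) * u $ i) = v" by (simp add: u_def)
    finally show ?thesis by simp
  qed
  moreover have "x \<in> states pq s" using x by (simp add: domain_D_def)
  ultimately show "x \<in> set_C edges B pv pq s" unfolding mem_set_C using phase cos by blast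
qed

section \<open>Strict convexity in the interior\<close>

lemma mem_int_C:
  "x \<in> int_C edges B pv pq s \<longleftrightarrow> x \<in> states pq s
    \<and> (\<exists>e>0. \<forall>y\<in>states pq s. dist y x < e \<longrightarrow> y \<in> set_C edges B pv pq s)"
proof -
  have "set_C edges B pv pq s \<subseteq> states pq s" using mem_set_C by blast
  then show ?thesis unfolding int_C_def by (rule mem_interior_of_subspace_iff)
qed

lemma convex_int_C: "convex (int_C edges B pv pq s)"
proof -
  have "set_C edges B pv pq s \<subseteq> states pq s" using mem_set_C by blast
  then show ?thesis
    unfolding int_C_def by (intro convex_interior_of_subspace subspace_states convex_set_C)
qed

lemma int_C_subset: "x \<in> int_C edges B pv pq s \<Longrightarrow> x \<in> set_C edges B pv pq s"
  unfolding mem_int_C by fastforce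

lemma int_C_perturb_phase:
  assumes x: "x \<in> int_C edges B pv pq s" and k: "k \<noteq> s"
  obtains e where "e > 0" "\<And>t. \<bar>t\<bar> < e \<Longrightarrow> x + t *\<^sub>R (0, axis k 1) \<in> set_C edges B pv pq s"
proof -
  obtain e where e: "x \<in> states pq s" "e > 0"
    "\<And>y. y \<in> states pq s \<Longrightarrow> dist y x < e \<Longrightarrow> y \<in> set_C edges B pv pq s"
    using x unfolding mem_int_C by blast
  have "x + t *\<^sub>R (0, axis k 1) \<in> set_C edges B pv pq s" if "\<bar>t\<bar> < e" for t
  proof (rule e(3))
    show "x + t *\<^sub>R (0, axis k 1) \<in> states pq s" using e(1) k by (simp add: mem_states axis_def)
    show "dist (x + t *\<^sub>R (0, axis k 1)) x < e" using that by (simp add: dist_norm norm_Pair)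
  qed
  with e(2) show thesis by (rule that)
qed

lemma int_C_cos_pos:
  assumes x: "x \<in> int_C edges B pv pq s" and e: "(i, j) \<in> edges"
  shows "0 < cos (snd x $ i - snd x $ j)"
proof -
  let ?t = "snd x $ i - snd x $ j"
  have "\<bar>?t\<bar> \<noteq> pi / 2"
  proof
    assume t: "\<bar>?t\<bar> = pi / 2"
    obtain k where k: "k \<noteq> s" "k = i \<or> k = j" using edge_neq[OF e] by metis
    obtain r where r: "r > 0" "\<And>t. \<bar>t\<bar> < r \<Longrightarrow> x + t *\<^sub>R (0, axis k 1) \<in> set_C edges B pv pq s"
      using int_C_perturb_phase[OF x k(1)] by blast
    \<comment> \<open>The direction in which moving \<open>\<theta>\<^sub>k\<close> enlarges the absolute phase difference.\<close>
    define \<sigma> :: real where "\<sigma> = (if k = i then 1 else - 1) * sgn ?t"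
    have "?t \<noteq> 0" using t pi_gt_zero by auto
    then have "\<bar>\<sigma>\<bar> = 1" by (simp add: \<sigma>_def abs_mult abs_sgn_eq)
    then have "\<bar>\<sigma> * (r / 2)\<bar> < r" using r(1) by (simp add: abs_mult)
    from set_C_phase_le[OF r(2)[OF this] e]
    have "\<bar>?t + sgn ?t * (r / 2)\<bar> \<le> pi / 2"
      using k(2) edge_neq[OF e] by (auto simp: \<sigma>_def axis_def algebra_simps)
    moreover have "\<bar>?t + sgn ?t * (r / 2)\<bar> = \<bar>?t\<bar> + r / 2"
      using r(1) \<open>?t \<noteq> 0\<close> by (cases "?t > 0") (auto simp: sgn_if)
    ultimately show False using t r(1) by linarith
  qed
  with set_C_phase_le[OF int_C_subset[OF x] e] have "\<bar>?t\<bar> < pi / 2" by linarith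
  then show ?thesis by (intro cos_gt_zero_pi) linarith+
qed

text \<open>
  If the form were not positive at \<open>v\<close>, it would not be positive at \<open>\<bar>v\<bar>\<close> either. Shifting
  \<open>\<theta>\<^sub>k\<close> by \<open>t\<close> and by \<open>- t\<close> stays inside the set, where the form is nonnegative, but the sum of
  the two values is strictly less than twice the value in the middle.
\<close>

lemma voltage_form_pos:
  assumes conn: "connected_network edges" and x: "x \<in> int_C edges B pv pq s"
    and v: "\<forall>i. i \<notin> pq \<longrightarrow> v i = 0" and k: "v k \<noteq> 0"
  shows "0 < voltage_form x v"
proof (rule ccontr)
  let ?v = "\<lambda>i. \<bar>v i\<bar>"
  assume "\<not> 0 < voltage_form x v"
  moreover have "voltage_form x ?v \<le> voltage_form x v"
    using set_C_cos_pos[OF int_C_subset[OF x]] v by (rule voltage_form_abs_le)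
  ultimately have le: "voltage_form x ?v \<le> 0" by linarith
  have kpq: "k \<in> pq" using v k by blast
  then have ks: "k \<noteq> s" using slack by blast
  obtain r where r: "r > 0" "\<And>t. \<bar>t\<bar> < r \<Longrightarrow> x + t *\<^sub>R (0, axis k 1) \<in> set_C edges B pv pq s"
    using int_C_perturb_phase[OF x ks] by blast
  define t where "t = min 1 (r / 2)"
  have t: "0 < t" "t \<le> 1" "t < r" using r(1) by (auto simp: t_def)
  define y z where "y = x + t *\<^sub>R (0, axis k 1)" and "z = x + (- t) *\<^sub>R (0, axis k 1)"
  have yz: "y \<in> set_C edges B pv pq s" "z \<in> set_C edges B pv pq s"
    unfolding y_def z_def using t by (intro r(2); simp)+
  have v': "\<forall>i. i \<notin> pq \<longrightarrow> ?v i = 0" using v by simp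
  have strict: "edge_voltage y ?v i j + edge_voltage z ?v i j < 2 * edge_voltage x ?v i j"
    if e: "(i, j) \<in> edges" and ij: "k = i \<or> k = j" for i j
  proof -
    let ?K = "(v i)\<^sup>2 * exp (fst x $ j - fst x $ i) + 2 * ?v i * ?v j + (v j)\<^sup>2 * exp (fst x $ i - fst x $ j)"
    let ?t = "snd x $ i - snd x $ j"
    have pq: "i \<in> pq \<or> j \<in> pq" using ij kpq by blast
    have fst: "fst y = fst x" "fst z = fst x" by (simp_all add: y_def z_def)
    have K: "?K > 0"
    proof (cases "k = i")
      case True
      with k show ?thesis by (intro add_pos_nonneg) auto
    next
      case False
      with ij k show ?thesis by (intro add_nonneg_pos) auto
    qed
    have "2 / cos ?t < 1 / cos (?t + t) + 1 / cos (?t - t)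
      \<and> 1 / cos (snd y $ i - snd y $ j) + 1 / cos (snd z $ i - snd z $ j) = 1 / cos (?t + t) + 1 / cos (?t - t)"
    proof -
      have "(snd y $ i - snd y $ j = ?t + t \<and> snd z $ i - snd z $ j = ?t - t)
          \<or> (snd y $ i - snd y $ j = ?t - t \<and> snd z $ i - snd z $ j = ?t + t)"
        using ij edge_neq[OF e] by (auto simp: y_def z_def axis_def)
      with set_C_cos_pos[OF yz(1) e pq] set_C_cos_pos[OF yz(2) e pq] set_C_cos_pos[OF int_C_subset[OF x] e pq] t
      show ?thesis using inverse_cos_strict_midpoint[of ?t t] by auto
    qed
    then have "?K * (2 / cos ?t) < ?K * (1 / cos (snd y $ i - snd y $ j) + 1 / cos (snd z $ i - snd z $ j))"
      using K by (intro mult_strict_left_mono) auto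
    moreover have "edge_voltage w ?v i j
        = 2 * (v i)\<^sup>2 + 2 * (v j)\<^sup>2 - ?K * (1 / cos (snd w $ i - snd w $ j))" if "fst w = fst x" for w
      using that by (simp add: edge_voltage_def)
    note this[OF fst(1)] this[OF fst(2)] this[OF refl]
    moreover have "?K * (2 / cos ?t) = 2 * (?K * (1 / cos ?t))" by simp
    ultimately show ?thesis unfolding distrib_left[of ?K] by linarith
  qed
  have weak: "edge_voltage y ?v i j + edge_voltage z ?v i j \<le> 2 * edge_voltage x ?v i j"
    if e: "(i, j) \<in> edges" for i j
  proof (cases "k = i \<or> k = j")
    case True
    with strict[OF e] show ?thesis by simp
  next
    case False
    then have "edge_voltage y ?v i j = edge_voltage x ?v i j" "edge_voltage z ?v i j = edge_voltage x ?v i j"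
      by (auto simp: edge_voltage_def y_def z_def axis_def)
    then show ?thesis by simp
  qed
  have weak': "B i j * edge_voltage y ?v i j + B i j * edge_voltage z ?v i j \<le> 2 * (B i j * edge_voltage x ?v i j)"
    if e: "(i, j) \<in> edges" for i j
    using mult_left_mono[OF weak[OF e], of "B i j"] edge_B_pos[OF e] by (simp add: algebra_simps)
  have strict': "B i j * edge_voltage y ?v i j + B i j * edge_voltage z ?v i j < 2 * (B i j * edge_voltage x ?v i j)"
    if e: "(i, j) \<in> edges" and ij: "k = i \<or> k = j" for i j
    using mult_strict_left_mono[OF strict[OF e ij] edge_B_pos[OF e]] by (simp add: algebra_simps)
  have "(k, s) \<in> (edges \<union> edges\<inverse>)\<^sup>*" using conn unfolding connected_network_def by blast
  then obtain l where "(k, l) \<in> edges \<union> edges\<inverse>" using ks by (metis converse_rtranclE)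
  then obtain i j where e: "(i, j) \<in> edges" "k = i \<or> k = j" by auto
  have "voltage_form y ?v + voltage_form z ?v < 2 * voltage_form x ?v"
    unfolding voltage_form_def sum.distrib[symmetric] sum_distrib_left split_def
  proof (rule sum_strict_mono_ex1)
    show "\<exists>a\<in>edges. B (fst a) (snd a) * edge_voltage y ?v (fst a) (snd a) + B (fst a) (snd a) * edge_voltage z ?v (fst a) (snd a)
        < 2 * (B (fst a) (snd a) * edge_voltage x ?v (fst a) (snd a))"
      using strict'[OF e] by (intro bexI[OF _ e(1)]) simp
  qed (simp_all add: weak')
  moreover have "0 \<le> voltage_form y ?v" "0 \<le> voltage_form z ?v"
    using set_C_voltage_form_nonneg[OF yz(1) v'] set_C_voltage_form_nonneg[OF yz(2) v'] by auto
  ultimately show False using le by linarith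
qed

text \<open>
  If \<open>u \<noteq> 0\<close>, the voltage form is already positive. If \<open>u = 0\<close>, the phase form is a weighted
  Laplacian form in \<open>w\<close> with positive weights, and \<open>w\<close> is pinned to 0 at the slack bus.
\<close>

lemma hess_form_pos:
  assumes conn: "connected_network edges" and x: "x \<in> int_C edges B pv pq s"
    and h: "h \<in> states pq s" "h \<noteq> 0"
  shows "0 < hess_form x h h"
proof (cases "fst h = 0")
  case False
  then obtain k where "exp (fst x $ k) * fst h $ k \<noteq> 0" by (auto simp: vec_eq_iff)
  moreover have "\<forall>i. i \<notin> pq \<longrightarrow> exp (fst x $ i) * fst h $ i = 0" using h by (simp add: mem_states)
  ultimately have "0 < voltage_form x (\<lambda>i. exp (fst x $ i) * fst h $ i)"
    by (intro voltage_form_pos[OF conn x])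
  then show ?thesis
    using phase_form_nonneg[OF int_C_subset[OF x], of h]
    unfolding hess_form_eq_on_set_C[OF int_C_subset[OF x] h(1)] by linarith
next
  case True
  have "phase_form x h \<noteq> 0"
  proof
    assume zero: "phase_form x h = 0"
    have edge: "snd h $ i = snd h $ j" if e: "(i, j) \<in> edges" for i j
    proof -
      let ?f = "\<lambda>(i, j). B i j * (exp (fst x $ i + fst x $ j) * cos (snd x $ i - snd x $ j) *
         (snd h $ i - snd h $ j + (fst h $ i + fst h $ j) * tan (snd x $ i - snd x $ j))\<^sup>2)"
      have nonneg: "0 \<le> ?f a" if "a \<in> edges" for a
      proof (cases a)
        case (Pair i j)
        then show ?thesis using that edge_B_pos[of i j] int_C_cos_pos[OF x, of i j] by simp
      qed
      have "?f (i, j) = 0"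
        using sum_nonneg_0[of edges ?f "(i, j)", OF _ nonneg] zero e unfolding phase_form_def by simp
      then show ?thesis
        using edge_B_pos[OF e] int_C_cos_pos[OF x e] True by simp
    qed
    have "snd h $ i = 0" for i
    proof -
      have "(i, s) \<in> (edges \<union> edges\<inverse>)\<^sup>*" using conn unfolding connected_network_def by blast
      then show ?thesis
      proof (induction rule: converse_rtrancl_induct)
        case base
        show ?case using h(1) by (simp add: mem_states)
      next
        case (step i j)
        then have "snd h $ i = snd h $ j" by (auto dest: edge)
        with step show ?case by simp
      qed
    qed
    then have "h = 0" using True by (simp add: prod_eq_iff vec_eq_iff)
    with h(2) show False by contradiction
  qed
  moreover have "0 \<le> phase_form x h" using int_C_subset[OF x] by (rule phase_form_nonneg)
  moreover have "0 \<le> voltage_form x (\<lambda>i. exp (fst x $ i) * fst h $ i)"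
    using True by (simp add: voltage_form_def edge_voltage_def)
  ultimately show ?thesis
    unfolding hess_form_eq_on_set_C[OF int_C_subset[OF x] h(1)] by linarith
qed

lemma strictly_convex_energy:
  assumes conn: "connected_network edges"
  shows "strictly_convex_on (int_C edges B pv pq s) (energy edges B pv pq P Q)"
  unfolding strictly_convex_on_def
proof (intro conjI ballI impI allI)
  show "convex (int_C edges B pv pq s)" by (rule convex_int_C)
next
  fix x y and u t :: real
  assume x: "x \<in> int_C edges B pv pq s" and y: "y \<in> int_C edges B pv pq s" and xy: "x \<noteq> y"
    and ut: "u > 0" "t > 0" "u + t = 1"
  let ?h = "y - x"
  have h: "?h \<in> states pq s" "?h \<noteq> 0"
    using x y xy subspace_states[of pq s] unfolding mem_int_C by (simp_all add: subspace_diff)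
  have "0 < hess_form (x + r *\<^sub>R ?h) ?h ?h" if "0 \<le> r" "r \<le> 1" for r
  proof -
    have "x + r *\<^sub>R ?h \<in> int_C edges B pv pq s"
      using convexD[OF convex_int_C x y, of "1 - r" r] that unfolding segment_eq by simp
    with conn show ?thesis using h by (rule hess_form_pos)
  qed
  then have "energy edges B pv pq P Q (x + t *\<^sub>R ?h)
      < (1 - t) * energy edges B pv pq P Q (x + 0 *\<^sub>R ?h) + t * energy edges B pv pq P Q (x + 1 *\<^sub>R ?h)"
    using ut by (intro pos_second_derivative_strict[OF energy_deriv energy_grad_deriv]) auto
  moreover have "u = 1 - t" using ut by simp
  ultimately show "energy edges B pv pq P Q (u *\<^sub>R x + t *\<^sub>R y)
      < u * energy edges B pv pq P Q x + t * energy edges B pv pq P Q y"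
    by (simp add: segment_eq)
qed

end

theorem mainTheorem1:
  fixes edges :: "('v::finite \<times> 'v) set"
    and B :: "'v \<Rightarrow> 'v \<Rightarrow> real"
    and pv pq :: "'v set"
    and s :: 'v
    and P Q :: "'v \<Rightarrow> real"
  assumes "power_network edges B pv pq s"
  shows "(convex (set_C edges B pv pq s)
        \<and> set_C edges B pv pq s \<subseteq> domain_D edges B pv pq s P Q
        \<and> convex_on (set_C edges B pv pq s) (energy edges B pv pq P Q))
      \<and> (is_tree edges \<longrightarrow> domain_D edges B pv pq s P Q = set_C edges B pv pq s)
      \<and> (connected_network edges \<longrightarrow>
          strictly_convex_on (int_C edges B pv pq s) (energy edges B pv pq P Q))"
  using convex_set_C[OF assms] set_C_subset_domain_D[OF assms] convex_energy[OF assms]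
    domain_D_subset_set_C[OF assms] strictly_convex_energy[OF assms]
  by (simp add: subset_antisym)

end
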